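(* Let $G$ be a positively $0$-transitive Lie superalgebra whose positive part $G_+$ is generated by $G_1$, and let $U$ be the universal Lie superalgebra associated to $U_1:=G_1$. (a) There exist a subspace $T_{0-}\subseteq U_{0-}$ such that $T_{0-}\oplus U_+$ is a subalgebra of $U$ (in particular $T_{0-}$ is a subalgebra of $U_{0-}$), and an ideal $D_{2+}$ of $T_{0-}\oplus U_+$ contained in $U_{2+}$, such that $G\cong(T_{0-}\oplus U_+)/D_{2+}$ as Lie superalgebras. (b) Conversely, for any subspace $T_{0-}\subseteq U_{0-}$ such that $T_{0-}\oplus U_+$ is a subalgebra of $U$ and any ideal $D_{2+}$ of $T_{0-}\oplus U_+$ contained in $U_{2+}$, the quotient $(T_{0-}\oplus U_+)/D_{2+}$ is a positively $0$-transitive Lie superalgebra whose positive part is generated by its degree-$1$ subspace.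
   Context: All vector spaces are over $\mathbb{K}=\mathbb{R}$ or $\mathbb{C}$, $\mathbb{Z}$-graded, parity equal to degree mod 2; morphisms preserve degree; subalgebras and ideals are graded. A Lie superalgebra is a graded space with degree-preserving bracket satisfying $[x,y]=-(-1)^{|x||y|}[y,x]$ and $[x,[y,z]]-(-1)^{|x||y|}[y,[x,z]]=[[x,y],z]$. $G_\pm=\bigoplus_{k\ge1}G_{\pm k}$, $G_{p-}=\bigoplus_{k\le p}G_k$, $G_{p+}=\bigoplus_{k\ge p}G_k$. $G$ is positively $0$-transitive if for $x\in G_{0-}$, $[G_+,x]=0$ implies $x=0$. Universal Lie superalgebra: for $U_1$ concentrated in degree 1 (odd), put $U_0=\mathrm{End}(U_1)$, $U_{-p+1}=\mathrm{Hom}(U_1,U_{-p+2})$ for $p\ge2$; on $U_{1-}=\bigoplus_{k\le1}U_k$ define brackets recursively by $[x,u]=x(u)$, $[u,x]=-(-1)^{|x|}x(u)$, $[x,y](u)=[x,y(u)]+(-1)^{|y|}[x(u),y]$ ($x,y\in U_{0-}$, $u\in U_1$), giving a semilocal Lie superalgebra (brackets defined when degrees sum to $\le1$); $U$ is the unique Lie superalgebra extending it such that $U_+$ is the free Lie superalgebra generated by $U_1$. *)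

theory Defs
  imports Complex_Main "HOL-Library.FuncSet"
begin

record ('k, 'a) lsa =
  lcarrier :: "'a set"
  lzero :: 'a
  ladd :: "'a \<Rightarrow> 'a \<Rightarrow> 'a"
  lneg :: "'a \<Rightarrow> 'a"
  lsmul :: "'k \<Rightarrow> 'a \<Rightarrow> 'a"
  ldeg :: "int \<Rightarrow> 'a set"
  lbr :: "'a \<Rightarrow> 'a \<Rightarrow> 'a"

definition K_is_R_or_C :: "'k::field itself \<Rightarrow> bool" where
  "K_is_R_or_C _ \<longleftrightarrow>
     (\<exists>f::'k \<Rightarrow> real. bij f \<and> (\<forall>a b. f (a + b) = f a + f b \<and> f (a * b) = f a * f b))
   \<or> (\<exists>f::'k \<Rightarrow> complex. bij f \<and> (\<forall>a b. f (a + b) = f a + f b \<and> f (a * b) = f a * f b))"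

definition vs :: "('k::field, 'a) lsa \<Rightarrow> bool" where
  "vs A \<longleftrightarrow>
     lzero A \<in> lcarrier A \<and>
     (\<forall>x\<in>lcarrier A. \<forall>y\<in>lcarrier A. ladd A x y \<in> lcarrier A) \<and>
     (\<forall>x\<in>lcarrier A. lneg A x \<in> lcarrier A) \<and>
     (\<forall>a. \<forall>x\<in>lcarrier A. lsmul A a x \<in> lcarrier A) \<and>
     (\<forall>x\<in>lcarrier A. \<forall>y\<in>lcarrier A. \<forall>z\<in>lcarrier A.
        ladd A (ladd A x y) z = ladd A x (ladd A y z)) \<and>
     (\<forall>x\<in>lcarrier A. \<forall>y\<in>lcarrier A. ladd A x y = ladd A y x) \<and>
     (\<forall>x\<in>lcarrier A. ladd A (lzero A) x = x) \<and>
     (\<forall>x\<in>lcarrier A. ladd A (lneg A x) x = lzero A) \<and>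
     (\<forall>a. \<forall>x\<in>lcarrier A. \<forall>y\<in>lcarrier A.
        lsmul A a (ladd A x y) = ladd A (lsmul A a x) (lsmul A a y)) \<and>
     (\<forall>a b. \<forall>x\<in>lcarrier A. lsmul A (a + b) x = ladd A (lsmul A a x) (lsmul A b x)) \<and>
     (\<forall>a b. \<forall>x\<in>lcarrier A. lsmul A (a * b) x = lsmul A a (lsmul A b x)) \<and>
     (\<forall>x\<in>lcarrier A. lsmul A 1 x = x)"

definition subspace :: "('k, 'a) lsa \<Rightarrow> 'a set \<Rightarrow> bool" where
  "subspace A V \<longleftrightarrow> V \<subseteq> lcarrier A \<and> lzero A \<in> V \<and>
     (\<forall>x\<in>V. \<forall>y\<in>V. ladd A x y \<in> V) \<and> (\<forall>a. \<forall>x\<in>V. lsmul A a x \<in> V)"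

definition lsum :: "('k, 'a) lsa \<Rightarrow> (int \<Rightarrow> 'a) \<Rightarrow> int list \<Rightarrow> 'a" where
  "lsum A c ks = foldr (\<lambda>k acc. ladd A (c k) acc) ks (lzero A)"

definition decomp :: "('k, 'a) lsa \<Rightarrow> 'a \<Rightarrow> (int \<Rightarrow> 'a) \<Rightarrow> bool" where
  "decomp A x c \<longleftrightarrow> (\<forall>k. c k \<in> ldeg A k) \<and>
     (\<exists>n::nat. (\<forall>k. (k < - int n \<or> int n < k) \<longrightarrow> c k = lzero A) \<and>
               x = lsum A c [- int n..int n])"

definition graded :: "('k, 'a) lsa \<Rightarrow> bool" where
  "graded A \<longleftrightarrow> (\<forall>k. subspace A (ldeg A k)) \<and> (\<forall>x\<in>lcarrier A. \<exists>!c. decomp A x c)"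

definition comp :: "('k, 'a) lsa \<Rightarrow> int \<Rightarrow> 'a \<Rightarrow> 'a" where
  "comp A k x = (THE c. decomp A x c) k"

definition sneg :: "('k, 'a) lsa \<Rightarrow> bool \<Rightarrow> 'a \<Rightarrow> 'a" where
  "sneg A e v = (if e then lneg A v else v)"

definition lie_superalgebra :: "('k::field, 'a) lsa \<Rightarrow> bool" where
  "lie_superalgebra A \<longleftrightarrow> vs A \<and> graded A \<and>
     (\<forall>x\<in>lcarrier A. \<forall>y\<in>lcarrier A. lbr A x y \<in> lcarrier A) \<and>
     (\<forall>x\<in>lcarrier A. \<forall>y\<in>lcarrier A. \<forall>z\<in>lcarrier A.
        lbr A (ladd A x y) z = ladd A (lbr A x z) (lbr A y z) \<and>
        lbr A z (ladd A x y) = ladd A (lbr A z x) (lbr A z y)) \<and>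
     (\<forall>a. \<forall>x\<in>lcarrier A. \<forall>y\<in>lcarrier A.
        lbr A (lsmul A a x) y = lsmul A a (lbr A x y) \<and>
        lbr A x (lsmul A a y) = lsmul A a (lbr A x y)) \<and>
     (\<forall>i j. \<forall>x\<in>ldeg A i. \<forall>y\<in>ldeg A j. lbr A x y \<in> ldeg A (i + j)) \<and>
     (\<forall>i j. \<forall>x\<in>ldeg A i. \<forall>y\<in>ldeg A j.
        lbr A x y = lneg A (sneg A (odd i \<and> odd j) (lbr A y x))) \<and>
     (\<forall>i j. \<forall>x\<in>ldeg A i. \<forall>y\<in>ldeg A j. \<forall>z\<in>lcarrier A.
        ladd A (lbr A x (lbr A y z)) (lneg A (sneg A (odd i \<and> odd j) (lbr A y (lbr A x z))))
          = lbr A (lbr A x y) z)"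

definition lsa_hom :: "('k, 'a) lsa \<Rightarrow> ('k, 'b) lsa \<Rightarrow> ('a \<Rightarrow> 'b) \<Rightarrow> bool" where
  "lsa_hom A B f \<longleftrightarrow> (\<forall>x\<in>lcarrier A. f x \<in> lcarrier B) \<and>
     (\<forall>x\<in>lcarrier A. \<forall>y\<in>lcarrier A. f (ladd A x y) = ladd B (f x) (f y)) \<and>
     (\<forall>a. \<forall>x\<in>lcarrier A. f (lsmul A a x) = lsmul B a (f x)) \<and>
     (\<forall>x\<in>lcarrier A. \<forall>y\<in>lcarrier A. f (lbr A x y) = lbr B (f x) (f y)) \<and>
     (\<forall>k. f ` ldeg A k \<subseteq> ldeg B k)"

definition lsa_iso :: "('k, 'a) lsa \<Rightarrow> ('k, 'b) lsa \<Rightarrow> ('a \<Rightarrow> 'b) \<Rightarrow> bool" where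
  "lsa_iso A B f \<longleftrightarrow> lsa_hom A B f \<and> bij_betw f (lcarrier A) (lcarrier B)"

definition substr :: "('k, 'a) lsa \<Rightarrow> 'a set \<Rightarrow> ('k, 'a) lsa" where
  "substr A S = A\<lparr>lcarrier := S, ldeg := (\<lambda>k. ldeg A k \<inter> S)\<rparr>"

definition graded_subspace :: "('k, 'a) lsa \<Rightarrow> 'a set \<Rightarrow> bool" where
  "graded_subspace A S \<longleftrightarrow> subspace A S \<and> (\<forall>x\<in>S. \<forall>k. comp A k x \<in> S)"

definition subalgebra :: "('k, 'a) lsa \<Rightarrow> 'a set \<Rightarrow> bool" where
  "subalgebra A S \<longleftrightarrow> graded_subspace A S \<and> (\<forall>x\<in>S. \<forall>y\<in>S. lbr A x y \<in> S)"

definition ideal :: "('k, 'a) lsa \<Rightarrow> 'a set \<Rightarrow> 'a set \<Rightarrow> bool" where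
  "ideal A S D \<longleftrightarrow> graded_subspace A D \<and> D \<subseteq> S \<and> (\<forall>x\<in>S. \<forall>d\<in>D. lbr A x d \<in> D)"

definition part :: "('k, 'a) lsa \<Rightarrow> (int \<Rightarrow> bool) \<Rightarrow> 'a set" where
  "part A P = {x \<in> lcarrier A. \<forall>k. \<not> P k \<longrightarrow> comp A k x = lzero A}"

definition dsum :: "('k, 'a) lsa \<Rightarrow> 'a set \<Rightarrow> 'a set \<Rightarrow> 'a set" where
  "dsum A V W = {ladd A v w | v w. v \<in> V \<and> w \<in> W}"

definition pos_0_transitive :: "('k, 'a) lsa \<Rightarrow> bool" where
  "pos_0_transitive A \<longleftrightarrow> (\<forall>x\<in>part A (\<lambda>k. k \<le> 0).
     (\<forall>y\<in>part A (\<lambda>k. 1 \<le> k). lbr A y x = lzero A) \<longrightarrow> x = lzero A)"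

inductive_set lie_span :: "('k, 'a) lsa \<Rightarrow> 'a set \<Rightarrow> 'a set" for A X where
  gen: "x \<in> X \<Longrightarrow> x \<in> lie_span A X"
| zero: "lzero A \<in> lie_span A X"
| add: "x \<in> lie_span A X \<Longrightarrow> y \<in> lie_span A X \<Longrightarrow> ladd A x y \<in> lie_span A X"
| smul: "x \<in> lie_span A X \<Longrightarrow> lsmul A a x \<in> lie_span A X"
| br: "x \<in> lie_span A X \<Longrightarrow> y \<in> lie_span A X \<Longrightarrow> lbr A x y \<in> lie_span A X"

definition pos_generated :: "('k, 'a) lsa \<Rightarrow> bool" where
  "pos_generated A \<longleftrightarrow> lie_span A (ldeg A 1) = part A (\<lambda>k. 1 \<le> k)"

text \<open>U_+ is the free Lie superalgebra generated by U_1 (graded universal property).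
  Test algebras L range over structures on the same type 'a; since the free Lie
  superalgebra on U_1 has cardinality at most that of U_1 (or is 0), this is
  equivalent to the universal property against all Lie superalgebras.\<close>
definition free_pos :: "('k::field, 'a) lsa \<Rightarrow> bool" where
  "free_pos U \<longleftrightarrow> (\<forall>L :: ('k, 'a) lsa. \<forall>f. lie_superalgebra L \<longrightarrow>
     (\<forall>u\<in>ldeg U 1. f u \<in> ldeg L 1) \<longrightarrow>
     (\<forall>u\<in>ldeg U 1. \<forall>v\<in>ldeg U 1. f (ladd U u v) = ladd L (f u) (f v)) \<longrightarrow>
     (\<forall>a. \<forall>u\<in>ldeg U 1. f (lsmul U a u) = lsmul L a (f u)) \<longrightarrow>
     (\<exists>!h. h \<in> extensional (part U (\<lambda>k. 1 \<le> k)) \<and>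
           lsa_hom (substr U (part U (\<lambda>k. 1 \<le> k))) L h \<and> (\<forall>u\<in>ldeg U 1. h u = f u)))"

definition linmaps :: "('k, 'a) lsa \<Rightarrow> 'a set \<Rightarrow> 'a set \<Rightarrow> ('a \<Rightarrow> 'a) set" where
  "linmaps A V W = {f \<in> extensional V. (\<forall>v\<in>V. f v \<in> W) \<and>
     (\<forall>u\<in>V. \<forall>v\<in>V. f (ladd A u v) = ladd A (f u) (f v)) \<and>
     (\<forall>a. \<forall>v\<in>V. f (lsmul A a v) = lsmul A a (f v))}"

text \<open>U is the universal Lie superalgebra associated with U_1 := G_1 (identified via the
  linear isomorphism j): U_+ free on U_1, and for k \<le> 0 the map x \<mapsto> (u \<mapsto> [x,u])
  identifies U_k with Hom(U_1, U_{k+1}) (so U_0 = End(U_1), U_{-p+1} = Hom(U_1,U_{-p+2}),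
  [x,u] = x(u)); the remaining brackets are then forced by the Lie superalgebra axioms.\<close>
definition universal_lsa :: "('k::field, 'g) lsa \<Rightarrow> ('k, 'a) lsa \<Rightarrow> ('g \<Rightarrow> 'a) \<Rightarrow> bool" where
  "universal_lsa G U j \<longleftrightarrow> lie_superalgebra U \<and>
     bij_betw j (ldeg G 1) (ldeg U 1) \<and>
     (\<forall>u\<in>ldeg G 1. \<forall>v\<in>ldeg G 1. j (ladd G u v) = ladd U (j u) (j v)) \<and>
     (\<forall>a. \<forall>u\<in>ldeg G 1. j (lsmul G a u) = lsmul U a (j u)) \<and>
     free_pos U \<and>
     (\<forall>k\<le>0. bij_betw (\<lambda>x. restrict (\<lambda>u. lbr U x u) (ldeg U 1))
                      (ldeg U k) (linmaps U (ldeg U 1) (ldeg U (k + 1))))"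

definition coset :: "('k, 'a) lsa \<Rightarrow> 'a set \<Rightarrow> 'a \<Rightarrow> 'a set" where
  "coset A D x = {ladd A x d | d. d \<in> D}"

definition quot :: "('k, 'a) lsa \<Rightarrow> 'a set \<Rightarrow> 'a set \<Rightarrow> ('k, 'a set) lsa" where
  "quot A S D = \<lparr> lcarrier = coset A D ` S,
     lzero = coset A D (lzero A),
     ladd = (\<lambda>X Y. coset A D (ladd A (SOME x. x \<in> X) (SOME y. y \<in> Y))),
     lneg = (\<lambda>X. coset A D (lneg A (SOME x. x \<in> X))),
     lsmul = (\<lambda>a X. coset A D (lsmul A a (SOME x. x \<in> X))),
     ldeg = (\<lambda>k. coset A D ` (S \<inter> ldeg A k)),
     lbr = (\<lambda>X Y. coset A D (lbr A (SOME x. x \<in> X) (SOME y. y \<in> Y))) \<rparr>"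

end

theory Submission
  imports Defs
begin

text \<open>Let \<open>V = {(j u, u)}\<close> be the graph of the identification of the degree-1 spaces, a subspace of
  degree 1 of \<open>U \<times> G\<close>, and let \<open>R\<close> be its prolongation: in positive degrees the subalgebra
  generated by \<open>V\<close>, and in degrees \<open>k \<le> 0\<close>, recursively, all \<open>z\<close> with \<open>[z, V] \<subseteq> R\<close>. The Jacobi
  identity makes \<open>R\<close> a graded subalgebra of \<open>U \<times> G\<close>. As \<open>U\<close> contains in non-positive degrees all
  linear maps on \<open>U\<^sub>1\<close>, and both positive parts are generated in degree 1, \<open>R\<close> projects onto \<open>G\<close>
  and its projection to \<open>U\<close> contains \<open>U\<^sub>+\<close>. Over \<open>U\<close> it is single-valued, by freeness of \<open>U\<^sub>+\<close> in
  positive degrees and by transitivity of \<open>G\<close> in the others; over \<open>G\<close> it is single-valued in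
  degrees \<open>\<le> 1\<close>. Hence \<open>G\<close> is the quotient of the projection \<open>T \<oplus> U\<^sub>+\<close> of \<open>R\<close> by an ideal
  contained in \<open>U\<^sub>2\<^sub>+\<close>. Conversely, dividing by such an ideal does not affect the brackets of
  elements of degree \<open>\<le> 0\<close> with \<open>U\<^sub>1\<close>, and these brackets determine the elements.\<close>

section \<open>Graded vector spaces\<close>

abbreviation (input) lsub :: "('k::field, 'a) lsa \<Rightarrow> 'a \<Rightarrow> 'a \<Rightarrow> 'a" where
  "lsub A x y \<equiv> ladd A x (lsmul A (- 1) y)"

abbreviation (input) pos_part :: "('k, 'a) lsa \<Rightarrow> 'a set" where
  "pos_part A \<equiv> part A (\<lambda>k. 1 \<le> k)"

lemma lsum_Nil [simp]: "lsum A c [] = lzero A"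
  and lsum_Cons [simp]: "lsum A c (k # ks) = ladd A (c k) (lsum A c ks)"
  by (simp_all add: lsum_def)

locale graded_vs =
  fixes A :: "('k::field, 'a) lsa"
  assumes vs: "vs A" and graded: "graded A"
begin

lemma zero_closed [simp]: "lzero A \<in> lcarrier A"
  and add_closed [simp]: "x \<in> lcarrier A \<Longrightarrow> y \<in> lcarrier A \<Longrightarrow> ladd A x y \<in> lcarrier A"
  and neg_closed [simp]: "x \<in> lcarrier A \<Longrightarrow> lneg A x \<in> lcarrier A"
  and smul_closed [simp]: "x \<in> lcarrier A \<Longrightarrow> lsmul A a x \<in> lcarrier A"
  using vs by (simp_all add: vs_def)

lemma add_assoc: "x \<in> lcarrier A \<Longrightarrow> y \<in> lcarrier A \<Longrightarrow> z \<in> lcarrier A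
    \<Longrightarrow> ladd A (ladd A x y) z = ladd A x (ladd A y z)"
  and add_commute: "x \<in> lcarrier A \<Longrightarrow> y \<in> lcarrier A \<Longrightarrow> ladd A x y = ladd A y x"
  and zero_add [simp]: "x \<in> lcarrier A \<Longrightarrow> ladd A (lzero A) x = x"
  and neg_add [simp]: "x \<in> lcarrier A \<Longrightarrow> ladd A (lneg A x) x = lzero A"
  and smul_add: "x \<in> lcarrier A \<Longrightarrow> y \<in> lcarrier A
    \<Longrightarrow> lsmul A a (ladd A x y) = ladd A (lsmul A a x) (lsmul A a y)"
  and add_smul: "x \<in> lcarrier A \<Longrightarrow> lsmul A (a + b) x = ladd A (lsmul A a x) (lsmul A b x)"
  and mul_smul: "x \<in> lcarrier A \<Longrightarrow> lsmul A (a * b) x = lsmul A a (lsmul A b x)"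
  and one_smul [simp]: "x \<in> lcarrier A \<Longrightarrow> lsmul A 1 x = x"
  using vs unfolding vs_def by blast+

lemma add_zero [simp]: "x \<in> lcarrier A \<Longrightarrow> ladd A x (lzero A) = x"
  using add_commute[of x "lzero A"] by simp

lemma add_neg [simp]: "x \<in> lcarrier A \<Longrightarrow> ladd A x (lneg A x) = lzero A"
  using add_commute[of x "lneg A x"] by simp

lemma add_left_commute: "x \<in> lcarrier A \<Longrightarrow> y \<in> lcarrier A \<Longrightarrow> z \<in> lcarrier A
    \<Longrightarrow> ladd A x (ladd A y z) = ladd A y (ladd A x z)"
  by (metis add_assoc add_commute)

lemmas add_ac = add_assoc add_commute add_left_commute

lemma add_left_cancel:
  assumes "x \<in> lcarrier A" "y \<in> lcarrier A" "z \<in> lcarrier A"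
  shows "ladd A x y = ladd A x z \<longleftrightarrow> y = z"
  by (metis assms add_assoc neg_add neg_closed zero_add)

lemma zero_smul [simp]:
  assumes "x \<in> lcarrier A" shows "lsmul A 0 x = lzero A"
  using add_smul[OF assms, of 0 0] add_left_cancel[of "lsmul A 0 x" "lsmul A 0 x" "lzero A"] assms
  by simp

lemma smul_zero [simp]: "lsmul A a (lzero A) = lzero A"
  using mul_smul[of "lzero A" a 0] by simp

lemma sub_self [simp]:
  assumes "x \<in> lcarrier A" shows "lsub A x x = lzero A"
  using add_smul[OF assms, of 1 "- 1"] assms by simp

lemma add_sub_cancel [simp]:
  assumes "x \<in> lcarrier A" "y \<in> lcarrier A" shows "ladd A y (lsub A x y) = x"
  using assms by (simp add: add_left_commute[of y x])

lemma sub_eq_zero_iff: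
  assumes "x \<in> lcarrier A" "y \<in> lcarrier A" shows "lsub A x y = lzero A \<longleftrightarrow> x = y"
  using add_sub_cancel[OF assms] add_zero[OF assms(2)] sub_self[OF assms(2)] by metis

lemma neg_eq:
  assumes "x \<in> lcarrier A" shows "lneg A x = lsmul A (- 1) x"
proof -
  have "ladd A x (lneg A x) = lsub A x x" using assms by simp
  then show ?thesis using assms by (simp only: add_left_cancel smul_closed neg_closed)
qed

lemma smul_eq_zeroD:
  assumes "x \<in> lcarrier A" "lsmul A a x = lzero A" "a \<noteq> 0" shows "x = lzero A"
  using mul_smul[OF assms(1), of "inverse a" a] assms by simp

lemma deg_carrier: "x \<in> ldeg A k \<Longrightarrow> x \<in> lcarrier A"
  and deg_zero [simp]: "lzero A \<in> ldeg A k"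
  and deg_add: "x \<in> ldeg A k \<Longrightarrow> y \<in> ldeg A k \<Longrightarrow> ladd A x y \<in> ldeg A k"
  and deg_smul: "x \<in> ldeg A k \<Longrightarrow> lsmul A a x \<in> ldeg A k"
  using graded by (auto simp: graded_def subspace_def)

lemma lsum_closed [simp]: "(\<And>k. c k \<in> lcarrier A) \<Longrightarrow> lsum A c ks \<in> lcarrier A"
  by (induction ks) auto

lemma lsum_add:
  assumes "\<And>k. c k \<in> lcarrier A" "\<And>k. d k \<in> lcarrier A"
  shows "lsum A (\<lambda>k. ladd A (c k) (d k)) ks = ladd A (lsum A c ks) (lsum A d ks)"
  by (induction ks) (simp_all add: assms add_ac)

lemma lsum_smul:
  assumes "\<And>k. c k \<in> lcarrier A"
  shows "lsum A (\<lambda>k. lsmul A a (c k)) ks = lsmul A a (lsum A c ks)"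
  by (induction ks) (simp_all add: assms smul_add)

lemma lsum_filter_nonzero:
  assumes "\<And>k. c k \<in> lcarrier A"
  shows "lsum A c (filter (\<lambda>k. c k \<noteq> lzero A) ks) = lsum A c ks"
  by (induction ks) (auto simp: assms)

lemma lsum_single:
  assumes "x \<in> lcarrier A" "distinct ks"
  shows "lsum A (\<lambda>k. if k = i then x else lzero A) ks = (if i \<in> set ks then x else lzero A)"
  using assms(2) by (induction ks) (use assms(1) in auto)

lemma lsum_widen:
  assumes "\<And>k. c k \<in> lcarrier A" "\<And>k. k < - int n \<or> int n < k \<Longrightarrow> c k = lzero A" "n \<le> m"
  shows "lsum A c [- int m..int m] = lsum A c [- int n..int n]"
proof -
  have "filter (\<lambda>k. c k \<noteq> lzero A) [- int m..int m] = filter (\<lambda>k. c k \<noteq> lzero A) [- int n..int n]"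
  proof (rule sorted_distinct_set_unique)
    show "set (filter (\<lambda>k. c k \<noteq> lzero A) [- int m..int m])
        = set (filter (\<lambda>k. c k \<noteq> lzero A) [- int n..int n])"
      using assms(2,3) by auto force+
  qed (simp_all add: sorted_wrt_filter)
  then show ?thesis
    using lsum_filter_nonzero[of c "[- int m..int m]"] lsum_filter_nonzero[of c "[- int n..int n]"]
      assms(1)
    by simp
qed

lemma decomp_iff_eventually:
  "decomp A x c \<longleftrightarrow> (\<forall>k. c k \<in> ldeg A k) \<and>
     (\<forall>\<^sub>F n in sequentially. (\<forall>k. k < - int n \<or> int n < k \<longrightarrow> c k = lzero A)
       \<and> x = lsum A c [- int n..int n])"
    (is "_ \<longleftrightarrow> _ \<and> eventually ?summed_up_to _")
proof (intro iffI conjI)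
  assume "decomp A x c"
  then obtain n where deg: "\<And>k. c k \<in> ldeg A k" and n: "?summed_up_to n"
    unfolding decomp_def by blast
  have "?summed_up_to m" if "n \<le> m" for m
    using lsum_widen[of c n m, OF deg_carrier[OF deg]] n that by auto
  then show "eventually ?summed_up_to sequentially"
    unfolding eventually_sequentially by blast
next
  assume "(\<forall>k. c k \<in> ldeg A k) \<and> eventually ?summed_up_to sequentially"
  then show "decomp A x c" unfolding decomp_def eventually_sequentially by blast
qed (simp add: decomp_def)

lemma decomp_in_deg: "decomp A x c \<Longrightarrow> c k \<in> ldeg A k"
  by (simp add: decomp_def)

lemma decomp_carrier: "decomp A x c \<Longrightarrow> x \<in> lcarrier A"
  unfolding decomp_def using lsum_closed deg_carrier by blast

lemma decomp_comp:
  assumes "x \<in> lcarrier A" shows "decomp A x (\<lambda>k. comp A k x)"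
proof -
  have "\<exists>!c. decomp A x c" using graded assms by (auto simp: graded_def)
  then show ?thesis unfolding comp_def by (rule theI')
qed

lemma comp_eqI: "decomp A x c \<Longrightarrow> comp A k x = c k"
  using graded decomp_carrier[of x c] decomp_comp[of x] unfolding graded_def by metis

lemma comp_deg [simp]: "x \<in> lcarrier A \<Longrightarrow> comp A k x \<in> ldeg A k"
  using decomp_comp by (auto simp: decomp_def)

lemma comp_carrier [simp]: "x \<in> lcarrier A \<Longrightarrow> comp A k x \<in> lcarrier A"
  using comp_deg deg_carrier by blast

lemma decomp_add:
  assumes "decomp A x c" "decomp A y d"
  shows "decomp A (ladd A x y) (\<lambda>k. ladd A (c k) (d k))"
proof -
  have closed: "\<And>k. c k \<in> lcarrier A" "\<And>k. d k \<in> lcarrier A"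
    using assms decomp_in_deg deg_carrier by blast+
  have "\<forall>\<^sub>F n in sequentially.
      (\<forall>k. k < - int n \<or> int n < k \<longrightarrow> c k = lzero A) \<and> x = lsum A c [- int n..int n]"
    "\<forall>\<^sub>F n in sequentially.
      (\<forall>k. k < - int n \<or> int n < k \<longrightarrow> d k = lzero A) \<and> y = lsum A d [- int n..int n]"
    using assms by (simp_all add: decomp_iff_eventually)
  then have "\<forall>\<^sub>F n in sequentially.
      (\<forall>k. k < - int n \<or> int n < k \<longrightarrow> ladd A (c k) (d k) = lzero A)
        \<and> ladd A x y = lsum A (\<lambda>k. ladd A (c k) (d k)) [- int n..int n]"
    by eventually_elim (simp add: lsum_add closed)
  then show ?thesis using assms by (simp add: decomp_iff_eventually deg_add)
qed

lemma decomp_smul: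
  assumes "decomp A x c"
  shows "decomp A (lsmul A a x) (\<lambda>k. lsmul A a (c k))"
proof -
  have "c k \<in> lcarrier A" for k using assms decomp_in_deg deg_carrier by blast
  moreover obtain n where "\<And>k. k < - int n \<or> int n < k \<Longrightarrow> c k = lzero A"
      "x = lsum A c [- int n..int n]"
    using assms unfolding decomp_def by blast
  ultimately show ?thesis
    using decomp_in_deg[OF assms]
    unfolding decomp_def by (intro conjI exI[of _ n]) (simp_all add: deg_smul lsum_smul)
qed

lemma decomp_homogeneous:
  assumes "x \<in> ldeg A i"
  shows "decomp A x (\<lambda>k. if k = i then x else lzero A)"
  unfolding decomp_def
proof (intro conjI exI[of _ "nat \<bar>i\<bar>"])
  show "x = lsum A (\<lambda>k. if k = i then x else lzero A) [- int (nat \<bar>i\<bar>)..int (nat \<bar>i\<bar>)]"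
    using lsum_single[OF deg_carrier[OF assms], of "[- \<bar>i\<bar>..\<bar>i\<bar>]" i] by (simp add: abs_if)
qed (use assms in auto)

lemma comp_add [simp]: "x \<in> lcarrier A \<Longrightarrow> y \<in> lcarrier A
    \<Longrightarrow> comp A k (ladd A x y) = ladd A (comp A k x) (comp A k y)"
  using comp_eqI[OF decomp_add[OF decomp_comp decomp_comp]] .

lemma comp_smul [simp]: "x \<in> lcarrier A \<Longrightarrow> comp A k (lsmul A a x) = lsmul A a (comp A k x)"
  using comp_eqI[OF decomp_smul[OF decomp_comp]] .

lemma comp_homogeneous: "x \<in> ldeg A i \<Longrightarrow> comp A k x = (if k = i then x else lzero A)"
  using comp_eqI[OF decomp_homogeneous] .

lemma comp_zero [simp]: "comp A k (lzero A) = lzero A"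
  using comp_homogeneous[of "lzero A" k k] by simp

lemma comp_comp [simp]:
  "x \<in> lcarrier A \<Longrightarrow> comp A i (comp A k x) = (if i = k then comp A k x else lzero A)"
  using comp_homogeneous[OF comp_deg] .

lemma graded_induct [consumes 1, case_names zero add comp]:
  assumes "x \<in> lcarrier A" "Q (lzero A)"
    and "\<And>u v. u \<in> lcarrier A \<Longrightarrow> v \<in> lcarrier A \<Longrightarrow> Q u \<Longrightarrow> Q v \<Longrightarrow> Q (ladd A u v)"
    and "\<And>k. Q (comp A k x)"
  shows "Q x"
proof -
  have "Q (lsum A (\<lambda>k. comp A k x) ks)" for ks
    by (induction ks) (use assms in simp_all)
  moreover obtain n where "x = lsum A (\<lambda>k. comp A k x) [- int n..int n]"
    using decomp_comp[OF assms(1)] unfolding decomp_def by blast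
  ultimately show ?thesis by metis
qed

lemma subspace_carrier: "subspace A V \<Longrightarrow> x \<in> V \<Longrightarrow> x \<in> lcarrier A"
  and subspace_zero: "subspace A V \<Longrightarrow> lzero A \<in> V"
  and subspace_add: "subspace A V \<Longrightarrow> x \<in> V \<Longrightarrow> y \<in> V \<Longrightarrow> ladd A x y \<in> V"
  and subspace_smul: "subspace A V \<Longrightarrow> x \<in> V \<Longrightarrow> lsmul A a x \<in> V"
  by (auto simp: subspace_def)

lemma subspace_by_comps:
  assumes V: "subspace A V" and "x \<in> lcarrier A" "\<And>k. comp A k x \<in> V"
  shows "x \<in> V"
  using assms(2) by (induction rule: graded_induct)
    (auto intro: assms(3) subspace_zero[OF V] subspace_add[OF V])

lemma subspace_deg: "subspace A (ldeg A k)"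
  using graded by (simp add: graded_def)

lemma subspace_singleton_zero: "subspace A {lzero A}"
  by (simp add: subspace_def)

lemma subspace_Int: "subspace A V \<Longrightarrow> subspace A W \<Longrightarrow> subspace A (V \<inter> W)"
  by (auto simp: subspace_def)

lemma dsumI: "v \<in> V \<Longrightarrow> w \<in> W \<Longrightarrow> ladd A v w \<in> dsum A V W"
  by (auto simp: dsum_def)

lemma subspace_dsum:
  assumes V: "subspace A V" and W: "subspace A W"
  shows "subspace A (dsum A V W)"
  unfolding subspace_def
proof (intro conjI ballI allI subsetI)
  show "lzero A \<in> dsum A V W"
    using dsumI[OF subspace_zero[OF V] subspace_zero[OF W]] by simp
next
  fix x assume "x \<in> dsum A V W"
  then obtain v w where vw: "v \<in> V" "w \<in> W" "x = ladd A v w" by (auto simp: dsum_def)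
  note [simp] = subspace_carrier[OF V vw(1)] subspace_carrier[OF W vw(2)]
  show "x \<in> lcarrier A" by (simp add: vw)
  show "lsmul A a x \<in> dsum A V W" for a
    using vw(1,2) subspace_smul[OF V] subspace_smul[OF W]
    by (simp add: vw(3) smul_add dsumI)
  fix y assume "y \<in> dsum A V W"
  then obtain v' w' where vw': "v' \<in> V" "w' \<in> W" "y = ladd A v' w'" by (auto simp: dsum_def)
  note [simp] = subspace_carrier[OF V vw'(1)] subspace_carrier[OF W vw'(2)]
  have "ladd A x y = ladd A (ladd A v v') (ladd A w w')" by (simp add: vw vw' add_ac)
  then show "ladd A x y \<in> dsum A V W"
    using vw vw' subspace_add[OF V] subspace_add[OF W] by (simp add: dsumI)
qed

lemma part_deg: "x \<in> ldeg A k \<Longrightarrow> P k \<Longrightarrow> x \<in> part A P"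
  using deg_carrier[of x k] comp_homogeneous[of x k] by (auto simp: part_def)

lemma deg_part_zero: "x \<in> ldeg A k \<Longrightarrow> x \<in> part A P \<Longrightarrow> \<not> P k \<Longrightarrow> x = lzero A"
  using comp_homogeneous[of x k k] by (simp add: part_def)

lemma graded_subspace_part: "graded_subspace A (part A P)"
  by (auto simp: graded_subspace_def subspace_def part_def)

lemma dsum_nonpos_pos_part:
  assumes S: "graded_subspace A S" and pos: "pos_part A \<subseteq> S"
  shows "dsum A (S \<inter> part A (\<lambda>k. k \<le> 0)) (pos_part A) = S"
proof -
  let ?N = "S \<inter> part A (\<lambda>k. k \<le> 0)"
  have sub: "subspace A S" and pos_sub: "subspace A (pos_part A)"
    using S graded_subspace_part by (simp_all add: graded_subspace_def)
  have nonpos_sub: "subspace A ?N"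
    using sub graded_subspace_part by (intro subspace_Int) (simp_all add: graded_subspace_def)
  have "x \<in> S" if "x \<in> dsum A ?N (pos_part A)" for x
    using that pos subspace_add[OF sub] by (auto simp: dsum_def)
  moreover have "x \<in> dsum A ?N (pos_part A)" if x: "x \<in> S" for x
  proof (rule subspace_by_comps[OF subspace_dsum[OF nonpos_sub pos_sub]])
    show x_carrier: "x \<in> lcarrier A" using sub x by (rule subspace_carrier)
    fix k
    show "comp A k x \<in> dsum A ?N (pos_part A)"
    proof (cases "k \<le> 0")
      case True
      then have "comp A k x \<in> ?N"
        using S x part_deg[OF comp_deg[OF x_carrier]] by (simp add: graded_subspace_def)
      from dsumI[OF this subspace_zero[OF pos_sub]] show ?thesis using x_carrier by simp
    next
      case False
      then have "comp A k x \<in> pos_part A" using part_deg[OF comp_deg[OF x_carrier]] by simp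
      from dsumI[OF subspace_zero[OF nonpos_sub] this] show ?thesis using x_carrier by simp
    qed
  qed
  ultimately show ?thesis by blast
qed

lemma subset_dsum_right: "subspace A V \<Longrightarrow> W \<subseteq> lcarrier A \<Longrightarrow> W \<subseteq> dsum A V W"
proof
  fix w assume "subspace A V" "W \<subseteq> lcarrier A" "w \<in> W"
  then show "w \<in> dsum A V W" using dsumI[OF subspace_zero, of V w W] zero_add[of w] by auto
qed

end

section \<open>Lie superalgebras\<close>

definition ssign :: "int \<Rightarrow> int \<Rightarrow> 'k::field" where
  "ssign i j = (if odd i \<and> odd j then - 1 else 1)"

locale lie_superalg =
  fixes A :: "('k::field, 'a) lsa"
  assumes lie: "lie_superalgebra A"

sublocale lie_superalg \<subseteq> graded_vs
  by unfold_locales (use lie in \<open>unfold lie_superalgebra_def, iprover+\<close>)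

context lie_superalg
begin

lemmas lie_axioms = lie[unfolded lie_superalgebra_def, THEN conjunct2, THEN conjunct2]

lemma br_closed [simp]: "x \<in> lcarrier A \<Longrightarrow> y \<in> lcarrier A \<Longrightarrow> lbr A x y \<in> lcarrier A"
  using lie_axioms[THEN conjunct1] by blast

lemma br_add_left: "x \<in> lcarrier A \<Longrightarrow> y \<in> lcarrier A \<Longrightarrow> z \<in> lcarrier A
    \<Longrightarrow> lbr A (ladd A x y) z = ladd A (lbr A x z) (lbr A y z)"
  and br_add_right: "x \<in> lcarrier A \<Longrightarrow> y \<in> lcarrier A \<Longrightarrow> z \<in> lcarrier A
    \<Longrightarrow> lbr A z (ladd A x y) = ladd A (lbr A z x) (lbr A z y)"
  using lie_axioms[THEN conjunct2, THEN conjunct1] by blast+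

lemma br_smul_left: "x \<in> lcarrier A \<Longrightarrow> y \<in> lcarrier A
    \<Longrightarrow> lbr A (lsmul A a x) y = lsmul A a (lbr A x y)"
  and br_smul_right: "x \<in> lcarrier A \<Longrightarrow> y \<in> lcarrier A
    \<Longrightarrow> lbr A x (lsmul A a y) = lsmul A a (lbr A x y)"
  using lie_axioms[THEN conjunct2, THEN conjunct2, THEN conjunct1] by blast+

lemma br_deg: "x \<in> ldeg A i \<Longrightarrow> y \<in> ldeg A j \<Longrightarrow> lbr A x y \<in> ldeg A (i + j)"
  using lie_axioms[THEN conjunct2, THEN conjunct2, THEN conjunct2, THEN conjunct1] by blast

lemma br_antisym_axiom: "x \<in> ldeg A i \<Longrightarrow> y \<in> ldeg A j
    \<Longrightarrow> lbr A x y = lneg A (sneg A (odd i \<and> odd j) (lbr A y x))"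
  using lie_axioms[THEN conjunct2, THEN conjunct2, THEN conjunct2, THEN conjunct2, THEN conjunct1]
  by blast

lemma br_jacobi_axiom: "x \<in> ldeg A i \<Longrightarrow> y \<in> ldeg A j \<Longrightarrow> z \<in> lcarrier A
    \<Longrightarrow> ladd A (lbr A x (lbr A y z)) (lneg A (sneg A (odd i \<and> odd j) (lbr A y (lbr A x z))))
          = lbr A (lbr A x y) z"
  using lie_axioms[THEN conjunct2, THEN conjunct2, THEN conjunct2, THEN conjunct2, THEN conjunct2]
  by blast

lemma br_zero_left [simp]: "x \<in> lcarrier A \<Longrightarrow> lbr A (lzero A) x = lzero A"
  using br_smul_left[of "lzero A" x 0] by simp

lemma br_zero_right [simp]: "x \<in> lcarrier A \<Longrightarrow> lbr A x (lzero A) = lzero A"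
  using br_smul_right[of x "lzero A" 0] by simp

lemma neg_sneg_eq:
  "x \<in> lcarrier A \<Longrightarrow> lneg A (sneg A (odd i \<and> odd j) x) = lsmul A (- ssign i j) x"
  by (simp add: sneg_def ssign_def neg_eq flip: mul_smul)

lemma br_antisym:
  assumes "x \<in> ldeg A i" "y \<in> ldeg A j"
  shows "lbr A x y = lsmul A (- ssign i j) (lbr A y x)"
  using br_antisym_axiom[OF assms] assms[THEN deg_carrier] by (simp only: neg_sneg_eq br_closed)

lemma br_jacobi:
  assumes "x \<in> ldeg A i" "y \<in> ldeg A j" "z \<in> lcarrier A"
  shows "lbr A (lbr A x y) z
    = ladd A (lbr A x (lbr A y z)) (lsmul A (- ssign i j) (lbr A y (lbr A x z)))"
  using br_jacobi_axiom[OF assms] assms(1,2)[THEN deg_carrier] assms(3)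
  by (simp only: neg_sneg_eq br_closed)

lemma br_derivation:
  assumes "x \<in> ldeg A i" "y \<in> ldeg A j" "z \<in> lcarrier A"
  shows "lbr A x (lbr A y z)
    = ladd A (lbr A (lbr A x y) z) (lsmul A (ssign i j) (lbr A y (lbr A x z)))"
proof -
  have [simp]: "x \<in> lcarrier A" "y \<in> lcarrier A" "z \<in> lcarrier A"
    using assms deg_carrier by auto
  have "ladd A (lsmul A (- ssign i j) (lbr A y (lbr A x z)))
      (lsmul A (ssign i j) (lbr A y (lbr A x z))) = lzero A"
    by (simp flip: add_smul)
  then show ?thesis by (simp add: br_jacobi[OF assms] add_assoc)
qed

lemma comp_br_right:
  assumes "u \<in> ldeg A i" "x \<in> lcarrier A"
  shows "comp A (i + k) (lbr A u x) = lbr A u (comp A k x)"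
  using assms(2)
proof (induction rule: graded_induct)
  case (comp j)
  then show ?case
    using comp_homogeneous[OF br_deg[OF assms(1) comp_deg[OF assms(2), of j]]]
      deg_carrier[OF assms(1)] assms(2)
    by auto
qed (use deg_carrier[OF assms(1)] in \<open>simp_all add: br_add_right\<close>)

lemma comp_br_left:
  assumes "u \<in> ldeg A i" "x \<in> lcarrier A"
  shows "comp A (k + i) (lbr A x u) = lbr A (comp A k x) u"
  using assms(2)
proof (induction rule: graded_induct)
  case (comp j)
  then show ?case
    using comp_homogeneous[OF br_deg[OF comp_deg[OF assms(2), of j] assms(1)]]
      deg_carrier[OF assms(1)] assms(2)
    by auto
qed (use deg_carrier[OF assms(1)] in \<open>simp_all add: br_add_left\<close>)

lemma br_in_subspace:
  assumes V: "subspace A V" and x: "x \<in> lcarrier A" and y: "y \<in> lcarrier A"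
    and comps: "\<And>i j. lbr A (comp A i x) (comp A j y) \<in> V"
  shows "lbr A x y \<in> V"
  using x
proof (induction rule: graded_induct)
  case (comp i)
  from y show "lbr A (comp A i x) y \<in> V"
    by (induction rule: graded_induct)
      (use x comps in \<open>auto simp: br_add_right intro: subspace_zero[OF V] subspace_add[OF V]\<close>)
qed (use y in \<open>auto simp: br_add_left intro: subspace_zero[OF V] subspace_add[OF V]\<close>)

lemma br_part:
  assumes x: "x \<in> part A P" and y: "y \<in> part A Q" and PQ: "\<And>i j. P i \<Longrightarrow> Q j \<Longrightarrow> R (i + j)"
  shows "lbr A x y \<in> part A R"
proof (rule br_in_subspace)
  show R: "subspace A (part A R)" using graded_subspace_part by (simp add: graded_subspace_def)
  show x_carrier: "x \<in> lcarrier A" and y_carrier: "y \<in> lcarrier A"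
    using x y by (auto simp: part_def)
  fix i j
  consider "P i" "Q j" | "comp A i x = lzero A" | "comp A j y = lzero A"
    using x y by (auto simp: part_def)
  then show "lbr A (comp A i x) (comp A j y) \<in> part A R"
  proof cases
    case 1
    then show ?thesis
      using part_deg[OF br_deg[OF comp_deg[OF x_carrier] comp_deg[OF y_carrier]]] PQ by blast
  qed (use x_carrier y_carrier subspace_zero[OF R] in auto)
qed

lemma subalgebraD:
  assumes "subalgebra A S"
  shows "graded_subspace A S" "subspace A S" "x \<in> S \<Longrightarrow> comp A k x \<in> S"
    "x \<in> S \<Longrightarrow> y \<in> S \<Longrightarrow> lbr A x y \<in> S"
  using assms by (auto simp: subalgebra_def graded_subspace_def)

lemma subalgebraI:
  assumes S: "graded_subspace A S"
    and br: "\<And>i j x y. x \<in> S \<inter> ldeg A i \<Longrightarrow> y \<in> S \<inter> ldeg A j \<Longrightarrow> lbr A x y \<in> S"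
  shows "subalgebra A S"
proof -
  have sub: "subspace A S" and comp: "\<And>x k. x \<in> S \<Longrightarrow> comp A k x \<in> S"
    using S by (auto simp: graded_subspace_def)
  have "lbr A x y \<in> S" if x: "x \<in> S" and y: "y \<in> S" for x y
  proof (rule br_in_subspace[OF sub])
    show "x \<in> lcarrier A" "y \<in> lcarrier A" using x y subspace_carrier[OF sub] by auto
    then show "lbr A (comp A i x) (comp A j y) \<in> S" for i j
      using br[of "comp A i x" i "comp A j y" j] comp x y by simp
  qed
  then show ?thesis using S by (simp add: subalgebra_def)
qed

lemma subalgebra_pos_part: "subalgebra A (pos_part A)"
  using graded_subspace_part br_part[where P = "\<lambda>k. 1 \<le> k" and Q = "\<lambda>k. 1 \<le> k"]
  by (simp add: subalgebra_def)

lemma lie_span_least: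
  assumes S: "subalgebra A S" and "X \<subseteq> S" shows "lie_span A X \<subseteq> S"
proof
  note sub = subalgebraD(2)[OF S]
  fix x assume "x \<in> lie_span A X"
  then show "x \<in> S"
    by induction (use assms(2) in \<open>auto intro: subspace_zero[OF sub] subspace_add[OF sub]
        subspace_smul[OF sub] subalgebraD(4)[OF S]\<close>)
qed

lemma subalgebra_lie_span:
  assumes X: "X \<subseteq> (\<Union>k. ldeg A k)"
  shows "subalgebra A (lie_span A X)"
proof -
  define C where "C = {x \<in> lcarrier A. \<forall>k. comp A k x \<in> lie_span A X}"
  have sub: "subspace A C" by (auto simp: subspace_def C_def intro: lie_span.intros)
  have homogeneous: "x \<in> C" if "x \<in> ldeg A k" "x \<in> lie_span A X" for x k
    using that comp_homogeneous[OF that(1)] deg_carrier by (auto simp: C_def intro: lie_span.zero)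
  have "lie_span A X \<subseteq> C"
  proof
    fix x assume "x \<in> lie_span A X"
    then show "x \<in> C"
    proof induction
      case (gen x)
      then obtain k where "x \<in> ldeg A k" using X by blast
      then show ?case using homogeneous[OF _ lie_span.gen[OF gen]] by simp
    next
      case (br x y)
      then have "lbr A (comp A i x) (comp A j y) \<in> C" for i j
        using homogeneous[OF br_deg[OF comp_deg comp_deg] lie_span.br] by (simp add: C_def)
      then show ?case by (rule br_in_subspace[OF sub, rotated 2]) (use br.IH in \<open>auto simp: C_def\<close>)
    qed (auto intro: subspace_zero[OF sub] subspace_add[OF sub] subspace_smul[OF sub])
  qed
  then show ?thesis
    unfolding subalgebra_def graded_subspace_def subspace_def
    by (auto simp: C_def intro: lie_span.intros)
qed

lemma lie_span_subset_pos_part: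
  assumes "X \<subseteq> ldeg A 1" shows "lie_span A X \<subseteq> pos_part A"
  using assms part_deg by (intro lie_span_least subalgebra_pos_part) auto

lemma lie_span_Int_deg_1:
  assumes X: "subspace A X" "X \<subseteq> ldeg A 1"
  shows "lie_span A X \<inter> ldeg A 1 = X"
proof -
  have comp_1: "x \<in> pos_part A \<and> comp A 1 x \<in> X" if "x \<in> lie_span A X" for x
    using that
  proof induction
    case (gen x)
    then have "x \<in> ldeg A 1" using X(2) by blast
    then show ?case using gen part_deg[of x 1] by (simp add: comp_homogeneous)
  next
    case (br x y)
    then have "lbr A x y \<in> part A (\<lambda>k. 2 \<le> k)"
      by (intro br_part[where P = "\<lambda>k. 1 \<le> k" and Q = "\<lambda>k. 1 \<le> k"]) auto
    then show ?case using subspace_zero[OF X(1)] by (auto simp: part_def)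
  qed (use subspace_zero[OF X(1)] subspace_add[OF X(1)] subspace_smul[OF X(1)] in
      \<open>auto simp: part_def\<close>)
  then have "x \<in> X" if "x \<in> lie_span A X" "x \<in> ldeg A 1" for x
    using comp_1[OF that(1)] comp_homogeneous[OF that(2), of 1] by simp
  then show ?thesis using X(2) by (auto intro: lie_span.gen)
qed

lemma pos_generatedI: "pos_part A \<subseteq> lie_span A (ldeg A 1) \<Longrightarrow> pos_generated A"
  using lie_span_subset_pos_part[of "ldeg A 1"] by (auto simp: pos_generated_def)

end

text \<open>For \<open>M = N\<close> this is the normalizer of \<open>M\<close>, for \<open>N = 0\<close> the centralizer of \<open>M\<close>.\<close>

definition transporter :: "('k, 'a) lsa \<Rightarrow> 'a set \<Rightarrow> 'a set \<Rightarrow> 'a set" where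
  "transporter A M N = {w \<in> lcarrier A. \<forall>z\<in>M. lbr A z w \<in> N}"

context lie_superalg
begin

lemma graded_subspace_transporter:
  assumes M: "graded_subspace A M" and N: "graded_subspace A N"
  shows "graded_subspace A (transporter A M N)"
proof -
  have M_sub: "subspace A M" and N_sub: "subspace A N"
    using M N by (simp_all add: graded_subspace_def)
  have "lbr A z (comp A k w) \<in> N" if w: "w \<in> transporter A M N" and z: "z \<in> M" for w z k
  proof -
    have carrier: "w \<in> lcarrier A" "z \<in> lcarrier A"
      using w z subspace_carrier[OF M_sub] by (auto simp: transporter_def)
    from carrier(2) show ?thesis
    proof (induction rule: graded_induct)
      case (comp i)
      have "comp A (i + k) (lbr A (comp A i z) w) \<in> N"
        using M N w z by (simp add: transporter_def graded_subspace_def)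
      then show ?case using comp_br_right[OF comp_deg[OF carrier(2)] carrier(1)] by simp
    qed (use carrier(1) subspace_zero[OF N_sub] subspace_add[OF N_sub] in
        \<open>auto simp: br_add_left\<close>)
  qed
  then show ?thesis
    unfolding graded_subspace_def subspace_def
    using subspace_carrier[OF M_sub] subspace_zero[OF N_sub] subspace_add[OF N_sub]
      subspace_smul[OF N_sub]
    by (auto simp: transporter_def br_add_right br_smul_right)
qed

lemma subalgebra_transporter:
  assumes M: "graded_subspace A M" and N: "graded_subspace A N" and NM: "N \<subseteq> M"
  shows "subalgebra A (transporter A M N)"
proof (rule subalgebraI[OF graded_subspace_transporter[OF M N]])
  have M_sub: "subspace A M" and N_sub: "subspace A N"
    using M N by (simp_all add: graded_subspace_def)
  have left: "lbr A w z \<in> N" if w: "w \<in> transporter A M N \<inter> ldeg A i" and z: "z \<in> M" for w z i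
  proof -
    have w_carrier: "w \<in> lcarrier A" using w by (simp add: transporter_def)
    from subspace_carrier[OF M_sub z] show ?thesis
    proof (induction rule: graded_induct)
      case (comp k)
      have "lbr A (comp A k z) w \<in> N"
        using w z M by (simp add: transporter_def graded_subspace_def)
      then show ?case
        using br_antisym[of w i "comp A k z" k] w subspace_carrier[OF M_sub z]
          subspace_smul[OF N_sub] by simp
    qed (use w_carrier subspace_zero[OF N_sub] subspace_add[OF N_sub] in \<open>auto simp: br_add_right\<close>)
  qed
  fix i j x y
  assume x: "x \<in> transporter A M N \<inter> ldeg A i" and y: "y \<in> transporter A M N \<inter> ldeg A j"
  then have x_carrier: "x \<in> lcarrier A" and y_carrier: "y \<in> lcarrier A"
    by (auto simp: transporter_def)
  have "lbr A z (lbr A x y) \<in> N" if z: "z \<in> M" for z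
    using subspace_carrier[OF M_sub z]
  proof (induction rule: graded_induct)
    case (comp k)
    have comp_z: "comp A k z \<in> M" using z M by (simp add: graded_subspace_def)
    then have "lbr A (comp A k z) x \<in> N" "lbr A (comp A k z) y \<in> N"
      using x y by (auto simp: transporter_def)
    then have "lbr A (lbr A (comp A k z) x) y \<in> N" "lbr A x (lbr A (comp A k z) y) \<in> N"
      using left[OF x] y NM by (auto simp: transporter_def)
    then show ?case
      using br_derivation[OF comp_deg[OF subspace_carrier[OF M_sub z]] _ y_carrier, of x i k] x
        subspace_add[OF N_sub] subspace_smul[OF N_sub] by simp
  qed (use x_carrier y_carrier subspace_zero[OF N_sub] subspace_add[OF N_sub]
      in \<open>auto simp: br_add_left\<close>)
  then show "lbr A x y \<in> transporter A M N" using x_carrier y_carrier by (simp add: transporter_def)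
qed

end

definition deg_1_transitive :: "('k, 'a) lsa \<Rightarrow> bool" where
  "deg_1_transitive A \<longleftrightarrow>
     (\<forall>k\<le>0. \<forall>x\<in>ldeg A k. (\<forall>u\<in>ldeg A 1. lbr A x u = lzero A) \<longrightarrow> x = lzero A)"

context lie_superalg
begin

lemma pos_0_transitive_if_deg_1_transitive:
  assumes "deg_1_transitive A" shows "pos_0_transitive A"
  unfolding pos_0_transitive_def
proof (intro ballI impI)
  fix x assume x: "x \<in> part A (\<lambda>k. k \<le> 0)" and central: "\<forall>y\<in>pos_part A. lbr A y x = lzero A"
  have x_carrier: "x \<in> lcarrier A" using x by (simp add: part_def)
  have "comp A k x = lzero A" for k
  proof (cases "k \<le> 0")
    case True
    have "lbr A (comp A k x) u = lzero A" if u: "u \<in> ldeg A 1" for u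
    proof -
      have "lbr A u x = lzero A" using central part_deg[OF u] by simp
      then have "lbr A u (comp A k x) = lzero A" using comp_br_right[OF u x_carrier, of k] by simp
      then show ?thesis using br_antisym[OF comp_deg[OF x_carrier] u] by simp
    qed
    then show ?thesis using assms True comp_deg[OF x_carrier] by (simp add: deg_1_transitive_def)
  next
    case False
    then show ?thesis using x by (simp add: part_def)
  qed
  then show "x = lzero A" using subspace_by_comps[OF subspace_singleton_zero x_carrier] by simp
qed

lemma deg_1_transitive_if_pos_0_transitive:
  assumes trans: "pos_0_transitive A" and gen: "pos_generated A"
  shows "deg_1_transitive A"
  unfolding deg_1_transitive_def
proof (intro allI impI ballI)
  fix k x assume k: "k \<le> 0" and x: "x \<in> ldeg A k" and central: "\<forall>u\<in>ldeg A 1. lbr A x u = lzero A"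
  note x_carrier = deg_carrier[OF x]
  define M where "M = range (\<lambda>a. lsmul A a x)"
  have M_sub: "subspace A M"
    using x_carrier by (auto simp: subspace_def M_def image_iff add_smul[symmetric]
        mul_smul[symmetric] intro: exI[of _ 0])
  have "comp A i (lsmul A a x) \<in> M" for i a
    using x_carrier subspace_zero[OF M_sub] by (simp add: M_def comp_homogeneous[OF x])
  with M_sub have "subalgebra A (transporter A M {lzero A})"
    by (intro subalgebra_transporter)
      (auto simp: graded_subspace_def M_def subspace_singleton_zero intro: subspace_zero)
  moreover have "ldeg A 1 \<subseteq> transporter A M {lzero A}"
    using central x_carrier deg_carrier by (auto simp: transporter_def M_def br_smul_left)
  ultimately have "pos_part A \<subseteq> transporter A M {lzero A}"
    using gen lie_span_least unfolding pos_generated_def by metis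
  moreover have "x \<in> M" unfolding M_def using one_smul[OF x_carrier] by (metis rangeI)
  ultimately have right: "lbr A x y = lzero A" if "y \<in> pos_part A" for y
    using that by (auto simp: transporter_def)
  have "lbr A y x = lzero A" if y: "y \<in> pos_part A" for y
  proof -
    have y_carrier: "y \<in> lcarrier A" using y by (simp add: part_def)
    then show ?thesis
    proof (induction rule: graded_induct)
      case (comp i)
      have "comp A i y \<in> pos_part A" using y by (auto simp: part_def)
      then show ?case using br_antisym[OF comp_deg[OF y_carrier] x, of i] right by simp
    qed (use x_carrier in \<open>simp_all add: br_add_left\<close>)
  qed
  then show "x = lzero A"
    using trans part_deg[OF x] k by (simp add: pos_0_transitive_def)
qed

end

section \<open>Subalgebras, epimorphic images, quotients and products\<close>

lemma substr_simps [simp]: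
  "lcarrier (substr A S) = S" "lzero (substr A S) = lzero A" "ladd (substr A S) = ladd A"
  "lneg (substr A S) = lneg A" "lsmul (substr A S) = lsmul A" "lbr (substr A S) = lbr A"
  "ldeg (substr A S) k = ldeg A k \<inter> S" "lsum (substr A S) = lsum A" "sneg (substr A S) = sneg A"
  by (auto simp: substr_def lsum_def sneg_def fun_eq_iff)

lemma decomp_substr: "decomp (substr A S) x c \<longleftrightarrow> decomp A x c \<and> (\<forall>k. c k \<in> S)"
  by (auto simp: decomp_def)

lemma lie_span_substr: "lie_span (substr A S) X = lie_span A X"
proof (intro equalityI subsetI)
  fix x assume "x \<in> lie_span (substr A S) X"
  then show "x \<in> lie_span A X"
    by induction (simp_all add: lie_span.intros)
next
  fix x assume "x \<in> lie_span A X"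
  then show "x \<in> lie_span (substr A S) X"
    by induction (use lie_span.intros[where A = "substr A S" and X = X] in simp_all)
qed

context lie_superalg
begin

lemma decomp_substr_iff:
  assumes S: "graded_subspace A S" and x: "x \<in> S"
  shows "decomp (substr A S) x c \<longleftrightarrow> c = (\<lambda>k. comp A k x)"
proof -
  have "x \<in> lcarrier A" "\<And>k. comp A k x \<in> S"
    using S x by (auto simp: graded_subspace_def subspace_def)
  then show ?thesis
    using decomp_comp[of x] comp_eqI[of x c] by (auto simp: decomp_substr)
qed

lemma comp_substr:
  assumes "graded_subspace A S" "x \<in> S"
  shows "comp (substr A S) k x = comp A k x"
  using decomp_substr_iff[OF assms] by (simp add: comp_def[of "substr A S"])

lemma part_substr: "graded_subspace A S \<Longrightarrow> part (substr A S) P = part A P \<inter> S"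
  by (auto simp: part_def comp_substr graded_subspace_def subspace_def)

lemma lie_superalgebra_substr:
  assumes S: "subalgebra A S"
  shows "lie_superalgebra (substr A S)"
proof -
  note sub = subalgebraD(2)[OF S]
  note closed = subspace_carrier[OF sub] subspace_zero[OF sub] subspace_add[OF sub]
    subspace_smul[OF sub]
  have neg: "lneg A x \<in> S" if "x \<in> S" for x
    using closed that by (simp add: neg_eq)
  have "vs (substr A S)"
    unfolding vs_def substr_simps
    by (intro conjI ballI allI)
      (simp_all add: closed neg add_ac smul_add add_smul mul_smul)
  moreover have "graded (substr A S)"
    unfolding graded_def using decomp_substr_iff[OF subalgebraD(1)[OF S]]
    by (auto simp: subspace_def closed intro: deg_add deg_smul)
  ultimately show ?thesis
    unfolding lie_superalgebra_def substr_simps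
    by (intro conjI ballI allI; (elim IntE)?)
      (assumption | (rule br_antisym_axiom, assumption+)
        | (rule br_jacobi_axiom, assumption+, erule closed(1))
        | simp add: closed subalgebraD(4)[OF S] br_add_left br_add_right br_smul_left br_smul_right
            br_deg)+
qed

lemma pos_generated_substr:
  assumes "pos_generated A" "graded_subspace A S" "pos_part A \<subseteq> S"
  shows "pos_generated (substr A S)"
proof -
  have "ldeg A 1 \<inter> S = ldeg A 1" using assms(3) part_deg[of _ 1 "\<lambda>k. 1 \<le> k"] by auto
  moreover have "pos_part (substr A S) = pos_part A" using assms(2,3) by (auto simp: part_substr)
  ultimately show ?thesis using assms(1) by (simp add: pos_generated_def lie_span_substr)
qed

lemma lie_span_carrier: "X \<subseteq> lcarrier A \<Longrightarrow> x \<in> lie_span A X \<Longrightarrow> x \<in> lcarrier A"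
  by (erule lie_span.induct) auto

end

locale lsa_epi = A: lie_superalg A for A :: "('k::field, 'a) lsa" +
  fixes B :: "('k, 'b) lsa" and f :: "'a \<Rightarrow> 'b"
  assumes image_carrier: "lcarrier B = f ` lcarrier A"
    and image_zero: "lzero B = f (lzero A)"
    and image_add: "\<And>x y. x \<in> lcarrier A \<Longrightarrow> y \<in> lcarrier A \<Longrightarrow> ladd B (f x) (f y) = f (ladd A x y)"
    and image_neg: "\<And>x. x \<in> lcarrier A \<Longrightarrow> lneg B (f x) = f (lneg A x)"
    and image_smul: "\<And>a x. x \<in> lcarrier A \<Longrightarrow> lsmul B a (f x) = f (lsmul A a x)"
    and image_br: "\<And>x y. x \<in> lcarrier A \<Longrightarrow> y \<in> lcarrier A \<Longrightarrow> lbr B (f x) (f y) = f (lbr A x y)"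
    and image_deg: "\<And>k. ldeg B k = f ` ldeg A k"
    and graded_kernel: "\<And>x k. x \<in> lcarrier A \<Longrightarrow> f x = f (lzero A) \<Longrightarrow> f (comp A k x) = f (lzero A)"
begin

lemma vs_image: "vs B"
  unfolding vs_def image_carrier image_zero ball_simps
  by (intro conjI ballI allI)
    (simp_all add: image_add image_neg image_smul A.add_ac A.smul_add A.add_smul A.mul_smul)

lemma lsum_image: "(\<And>k. c k \<in> lcarrier A) \<Longrightarrow> lsum B (\<lambda>k. f (c k)) ks = f (lsum A c ks)"
  by (induction ks) (simp_all add: image_zero image_add)

lemma image_eq_iff:
  assumes "x \<in> lcarrier A" "y \<in> lcarrier A"
  shows "f x = f y \<longleftrightarrow> f (lsub A x y) = f (lzero A)"
proof
  assume "f x = f y"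
  then have "ladd B (f x) (f (lsmul A (- 1) y)) = ladd B (f y) (f (lsmul A (- 1) y))" by simp
  then show "f (lsub A x y) = f (lzero A)" using assms by (simp add: image_add)
next
  assume "f (lsub A x y) = f (lzero A)"
  then have "ladd B (f y) (f (lsub A x y)) = ladd B (f y) (f (lzero A))" by simp
  then show "f x = f y" using assms by (simp add: image_add)
qed

lemma decomp_image:
  assumes "decomp A x c" shows "decomp B (f x) (\<lambda>k. f (c k))"
proof -
  have "\<And>k. c k \<in> lcarrier A" using A.decomp_in_deg[OF assms] A.deg_carrier by blast
  then show ?thesis
    using assms unfolding decomp_def image_deg image_zero by (metis image_eqI lsum_image)
qed

lemma decomp_image_unique:
  assumes C: "decomp B (f x) C" and x: "x \<in> lcarrier A"
  shows "C = (\<lambda>k. f (comp A k x))"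
proof
  fix k
  obtain n where deg_C: "\<And>k. C k \<in> ldeg B k"
      and bound: "\<And>k. k < - int n \<or> int n < k \<Longrightarrow> C k = lzero B"
      and sum_C: "f x = lsum B C [- int n..int n]"
    using C unfolding decomp_def by blast
  have "\<exists>c. c \<in> ldeg A k \<and> C k = f c \<and> (k < - int n \<or> int n < k \<longrightarrow> c = lzero A)" for k
    using deg_C[of k] bound[of k]
    by (cases "k < - int n \<or> int n < k") (auto simp: image_deg image_zero)
  then obtain c where deg_c: "\<And>k. c k \<in> ldeg A k" and C_eq: "C = (\<lambda>k. f (c k))"
      and "\<And>k. k < - int n \<or> int n < k \<Longrightarrow> c k = lzero A"
    by metis
  then have decomp_c: "decomp A (lsum A c [- int n..int n]) c" unfolding decomp_def by blast
  note sum_carrier = A.decomp_carrier[OF decomp_c]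
  have "f x = f (lsum A c [- int n..int n])"
    using sum_C A.deg_carrier[OF deg_c] by (simp add: C_eq lsum_image)
  then have "f (comp A k (lsub A x (lsum A c [- int n..int n]))) = f (lzero A)"
    using x sum_carrier image_eq_iff[OF x sum_carrier] by (intro graded_kernel) simp_all
  then show "C k = f (comp A k x)"
    using x sum_carrier A.deg_carrier[OF deg_c] A.comp_eqI[OF decomp_c]
      image_eq_iff[of "comp A k x" "c k"]
    by (simp add: C_eq)
qed

lemma graded_image: "graded B"
  unfolding graded_def
proof (intro conjI allI ballI)
  show "subspace B (ldeg B k)" for k
    unfolding subspace_def image_deg image_zero image_carrier using A.deg_carrier
    by (auto simp: image_add image_smul intro!: imageI A.deg_add A.deg_smul)
  fix y assume "y \<in> lcarrier B"
  then obtain x where x: "y = f x" "x \<in> lcarrier A" by (auto simp: image_carrier)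
  show "\<exists>!c. decomp B y c"
    unfolding x(1)
    using decomp_image[OF A.decomp_comp[OF x(2)]] decomp_image_unique[OF _ x(2)] by (rule ex1I)
qed

lemma lie_superalgebra_image: "lie_superalgebra B"
proof -
  have sneg: "sneg B e (f x) = f (sneg A e x)" "sneg A e x \<in> lcarrier A"
    if "x \<in> lcarrier A" for e x
    using that by (simp_all add: sneg_def image_neg)
  have antisym: "lbr B (f x) (f y) = lneg B (sneg B (odd i \<and> odd j) (lbr B (f y) (f x)))"
    if "x \<in> ldeg A i" "y \<in> ldeg A j" for x y i j
    using that[THEN A.deg_carrier] A.br_antisym_axiom[OF that]
    by (simp add: image_br sneg image_neg)
  have jacobi: "ladd B (lbr B (f x) (lbr B (f y) (f z)))
        (lneg B (sneg B (odd i \<and> odd j) (lbr B (f y) (lbr B (f x) (f z)))))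
      = lbr B (lbr B (f x) (f y)) (f z)"
    if "x \<in> ldeg A i" "y \<in> ldeg A j" "z \<in> lcarrier A" for x y z i j
    using that(1,2)[THEN A.deg_carrier] that(3) A.br_jacobi_axiom[OF that]
    by (simp add: image_br sneg image_neg image_add)
  have br_deg: "lbr B (f x) (f y) \<in> f ` ldeg A (i + j)"
    if "x \<in> ldeg A i" "y \<in> ldeg A j" for x y i j
    using that[THEN A.deg_carrier] A.br_deg[OF that] by (simp add: image_br)
  show ?thesis
    unfolding lie_superalgebra_def image_carrier image_deg ball_simps
    by (intro conjI ballI allI vs_image graded_image)
      ((rule antisym, assumption, assumption) | (rule jacobi, assumption+)
        | (rule br_deg, assumption+)
        | simp add: image_br image_add image_smul A.br_add_left A.br_add_right
            A.br_smul_left A.br_smul_right)+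
qed

end

sublocale lsa_epi \<subseteq> B: lie_superalg B
  by (rule lie_superalg.intro[OF lie_superalgebra_image])

context lsa_epi
begin

lemma comp_image: "x \<in> lcarrier A \<Longrightarrow> comp B k (f x) = f (comp A k x)"
  using B.comp_eqI[OF decomp_image[OF A.decomp_comp]] .

lemma subspace_image: "subspace A V \<Longrightarrow> subspace B (f ` V)"
  unfolding subspace_def image_carrier image_zero
  by (auto simp: image_add image_smul subset_iff intro!: imageI)

lemma subalgebra_image:
  assumes "subalgebra A S" shows "subalgebra B (f ` S)"
proof -
  have closed: "x \<in> lcarrier A" if "x \<in> S" for x
    using that assms A.subalgebraD(2) A.subspace_carrier by blast
  show ?thesis
    unfolding subalgebra_def graded_subspace_def
    using subspace_image[OF A.subalgebraD(2)[OF assms]] A.subalgebraD(3,4)[OF assms] closed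
    by (auto simp: comp_image image_br)
qed

lemma lie_span_image:
  assumes X: "X \<subseteq> lcarrier A" shows "lie_span B (f ` X) = f ` lie_span A X"
proof (intro equalityI subsetI)
  note closed = A.lie_span_carrier[OF X]
  fix y assume "y \<in> lie_span B (f ` X)"
  then show "y \<in> f ` lie_span A X"
  proof induction
    case zero
    then show ?case using lie_span.zero[of A X] by (simp add: image_zero)
  qed (auto simp: image_add image_smul image_br closed intro: lie_span.intros)
next
  note closed = A.lie_span_carrier[OF X]
  have "f x \<in> lie_span B (f ` X)" if "x \<in> lie_span A X" for x
    using that
  proof induction
    case zero
    then show ?case using lie_span.zero[of B] by (simp add: image_zero)
  qed (auto simp: closed image_add[symmetric] image_smul[symmetric] image_br[symmetric]
      intro: lie_span.intros)
  then show "y \<in> lie_span B (f ` X)" if "y \<in> f ` lie_span A X" for y using that by blast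
qed

lemma part_image: "part B P = f ` part A P"
proof (intro equalityI subsetI)
  fix y assume y: "y \<in> part B P"
  then obtain x where x: "x \<in> lcarrier A" "y = f x" by (auto simp: part_def image_carrier)
  have sub: "subspace B (f ` part A P)"
    using A.graded_subspace_part by (intro subspace_image) (simp add: graded_subspace_def)
  have "comp B k y \<in> f ` part A P" for k
  proof (cases "P k")
    case True
    then have "comp A k x \<in> part A P" using A.part_deg[OF A.comp_deg[OF x(1)]] by blast
    then show ?thesis using x by (simp add: comp_image)
  next
    case False
    then show ?thesis using y B.subspace_zero[OF sub] by (simp add: part_def)
  qed
  then show "y \<in> f ` part A P"
    by (rule B.subspace_by_comps[OF sub, rotated]) (use y in \<open>simp add: part_def\<close>)
next
  fix y assume "y \<in> f ` part A P"
  then obtain x where x: "x \<in> part A P" "y = f x" by blast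
  then have "x \<in> lcarrier A" by (simp add: part_def)
  with x show "y \<in> part B P" by (simp add: part_def image_carrier comp_image image_zero)
qed

lemma pos_generated_image: "pos_generated A \<Longrightarrow> pos_generated B"
  using lie_span_image[of "ldeg A 1"] A.deg_carrier
  by (auto simp: pos_generated_def part_image image_deg)

end

lemma quot_simps [simp]:
  "lcarrier (quot A S D) = coset A D ` S" "lzero (quot A S D) = coset A D (lzero A)"
  "ldeg (quot A S D) k = coset A D ` (S \<inter> ldeg A k)"
  by (simp_all add: quot_def)

locale lsa_quot = lie_superalg A for A :: "('k::field, 'a) lsa" +
  fixes S D
  assumes S: "subalgebra A S" and D: "ideal A S D"
begin

lemma D_subspace: "subspace A D"
  and D_comp: "d \<in> D \<Longrightarrow> comp A k d \<in> D"
  and D_in_S: "d \<in> D \<Longrightarrow> d \<in> S"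
  and D_br_right: "x \<in> S \<Longrightarrow> d \<in> D \<Longrightarrow> lbr A x d \<in> D"
  using D by (auto simp: ideal_def graded_subspace_def)

lemmas S_carrier = subspace_carrier[OF subalgebraD(2)[OF S]]
lemmas D_carrier = subspace_carrier[OF D_subspace]
lemmas D_zero = subspace_zero[OF D_subspace]
lemmas D_add = subspace_add[OF D_subspace]
lemmas D_smul = subspace_smul[OF D_subspace]

lemma D_br_left:
  assumes d: "d \<in> D" and x: "x \<in> S" shows "lbr A d x \<in> D"
proof (rule br_in_subspace[OF D_subspace])
  show d_carrier: "d \<in> lcarrier A" and x_carrier: "x \<in> lcarrier A"
    using d x D_carrier S_carrier by auto
  show "lbr A (comp A i d) (comp A j x) \<in> D" for i j
    using br_antisym[OF comp_deg[OF d_carrier] comp_deg[OF x_carrier], of i j]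
      D_br_right[OF subalgebraD(3)[OF S x] D_comp[OF d]]
    by (simp add: D_smul)
qed

lemma coset_eq_iff:
  assumes x: "x \<in> lcarrier A" and y: "y \<in> lcarrier A"
  shows "coset A D x = coset A D y \<longleftrightarrow> lsub A x y \<in> D"
proof
  assume "coset A D x = coset A D y"
  moreover have "x \<in> coset A D x" using x D_zero by (force simp: coset_def)
  ultimately obtain d where d: "d \<in> D" "x = ladd A y d" by (auto simp: coset_def)
  have "ladd A y (lsub A x y) = ladd A y d" using d x y by simp
  then show "lsub A x y \<in> D"
    using d x y D_carrier add_left_cancel[of y "lsub A x y" d] by simp
next
  have subset: "coset A D u \<subseteq> coset A D v"
    if "u \<in> lcarrier A" "v \<in> lcarrier A" "lsub A u v \<in> D" for u v
  proof
    fix z assume "z \<in> coset A D u"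
    then obtain d where d: "d \<in> D" "z = ladd A u d" by (auto simp: coset_def)
    have "z = ladd A (ladd A v (lsub A u v)) d" using that d by simp
    then have "z = ladd A v (ladd A (lsub A u v) d)"
      using that d D_carrier by (simp only: add_assoc add_closed smul_closed)
    then show "z \<in> coset A D v" using D_add that d by (auto simp: coset_def)
  qed
  assume xy: "lsub A x y \<in> D"
  have "lsub A y x = lsmul A (- 1) (lsub A x y)"
    using x y by (simp add: smul_add add_commute flip: mul_smul)
  then have "lsub A y x \<in> D" using D_smul[OF xy, of "- 1"] by simp
  then show "coset A D x = coset A D y" using subset x y xy by blast
qed

lemma coset_add_D: "x \<in> lcarrier A \<Longrightarrow> d \<in> D \<Longrightarrow> coset A D (ladd A x d) = coset A D x"
  by (simp add: coset_eq_iff D_carrier add_assoc add_left_commute[of d x])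

lemma coset_eq_zero_iff: "x \<in> lcarrier A \<Longrightarrow> coset A D x = coset A D (lzero A) \<longleftrightarrow> x \<in> D"
  by (simp add: coset_eq_iff)

lemma some_in_coset:
  assumes "x \<in> S"
  obtains d where "d \<in> D" "d \<in> lcarrier A" "(SOME y. y \<in> coset A D x) = ladd A x d"
proof -
  have "(SOME y. y \<in> coset A D x) \<in> coset A D x"
    by (rule someI[of _ "ladd A x (lzero A)"]) (use D_zero in \<open>auto simp: coset_def\<close>)
  then show thesis using that D_carrier by (auto simp: coset_def)
qed

lemma quot_smul:
  assumes "x \<in> S"
  shows "lsmul (quot A S D) a (coset A D x) = coset A D (lsmul A a x)"
proof -
  obtain d where "d \<in> D" "d \<in> lcarrier A" "(SOME z. z \<in> coset A D x) = ladd A x d"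
    using some_in_coset[OF assms] .
  then show ?thesis using S_carrier[OF assms] by (simp add: quot_def smul_add coset_add_D D_smul)
qed

lemma quot_neg:
  assumes "x \<in> S"
  shows "lneg (quot A S D) (coset A D x) = coset A D (lneg A x)"
proof -
  obtain d where "d \<in> D" "d \<in> lcarrier A" "(SOME z. z \<in> coset A D x) = ladd A x d"
    using some_in_coset[OF assms] .
  then show ?thesis
    using S_carrier[OF assms] by (simp add: quot_def neg_eq smul_add coset_add_D D_smul)
qed

lemma quot_add:
  assumes x: "x \<in> S" and y: "y \<in> S"
  shows "ladd (quot A S D) (coset A D x) (coset A D y) = coset A D (ladd A x y)"
proof -
  obtain d where d: "d \<in> D" "d \<in> lcarrier A" "(SOME z. z \<in> coset A D x) = ladd A x d"
    using some_in_coset[OF x] .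
  obtain e where e: "e \<in> D" "e \<in> lcarrier A" "(SOME z. z \<in> coset A D y) = ladd A y e"
    using some_in_coset[OF y] .
  have "ladd A (ladd A x d) (ladd A y e) = ladd A (ladd A x y) (ladd A d e)"
    using x[THEN S_carrier] y[THEN S_carrier] d(2) e(2) by (simp add: add_ac)
  then show ?thesis using x y d e by (simp add: quot_def coset_add_D D_add S_carrier)
qed

lemma quot_br:
  assumes x: "x \<in> S" and y: "y \<in> S"
  shows "lbr (quot A S D) (coset A D x) (coset A D y) = coset A D (lbr A x y)"
proof -
  obtain d where d: "d \<in> D" "d \<in> lcarrier A" "(SOME z. z \<in> coset A D x) = ladd A x d"
    using some_in_coset[OF x] .
  obtain e where e: "e \<in> D" "e \<in> lcarrier A" "(SOME z. z \<in> coset A D y) = ladd A y e"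
    using some_in_coset[OF y] .
  note [simp] = x[THEN S_carrier] y[THEN S_carrier] d(2) e(2)
  have "lbr A (ladd A x d) (ladd A y e)
      = ladd A (lbr A x y) (ladd A (lbr A x e) (ladd A (lbr A d y) (lbr A d e)))"
    by (simp add: br_add_left br_add_right add_ac)
  moreover have "ladd A (lbr A x e) (ladd A (lbr A d y) (lbr A d e)) \<in> D"
    using x y d e D_in_S by (intro D_add D_br_right D_br_left) auto
  ultimately show ?thesis using d e by (simp add: quot_def coset_add_D)
qed

lemma quot_epi: "lsa_epi (substr A S) (quot A S D) (coset A D)"
proof (intro lsa_epi.intro lie_superalg.intro lie_superalgebra_substr S lsa_epi_axioms.intro)
  show "coset A D (comp (substr A S) k x) = coset A D (lzero (substr A S))"
    if "x \<in> lcarrier (substr A S)" "coset A D x = coset A D (lzero (substr A S))" for x k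
    using that comp_substr[OF subalgebraD(1)[OF S]] S_carrier D_comp
    by (simp add: coset_eq_zero_iff)
qed (auto simp: quot_add quot_smul quot_neg quot_br)

end

sublocale lsa_quot \<subseteq> coset: lsa_epi "substr A S" "quot A S D" "coset A D"
  by (rule quot_epi)

context lsa_quot
begin

lemma deg_1_transitive_quot:
  assumes trans: "deg_1_transitive A" and pos: "pos_part A \<subseteq> S" and D_pos: "D \<subseteq> part A (\<lambda>k. 2 \<le> k)"
  shows "deg_1_transitive (quot A S D)"
  unfolding deg_1_transitive_def
proof (intro allI impI ballI)
  fix k X assume k: "k \<le> 0" and X: "X \<in> ldeg (quot A S D) k"
    and central: "\<forall>Y\<in>ldeg (quot A S D) 1. lbr (quot A S D) X Y = lzero (quot A S D)"
  obtain x where x: "x \<in> S" "x \<in> ldeg A k" "X = coset A D x" using X by auto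
  have "lbr A x u = lzero A" if u: "u \<in> ldeg A 1" for u
  proof -
    have u_in_S: "u \<in> S" using u pos part_deg[of u 1] by auto
    then have "lbr (quot A S D) X (coset A D u) = lzero (quot A S D)" using central u by simp
    then have "lbr A x u \<in> D"
      using x u_in_S by (simp add: quot_br coset_eq_zero_iff S_carrier)
    then show ?thesis using deg_part_zero[OF br_deg[OF x(2) u]] D_pos k by force
  qed
  then have "x = lzero A" using trans k x(2) by (simp add: deg_1_transitive_def)
  then show "X = lzero (quot A S D)" by (simp add: x(3))
qed

end

definition prod_lsa :: "('k, 'a) lsa \<Rightarrow> ('k, 'b) lsa \<Rightarrow> ('k, 'a \<times> 'b) lsa" where
  "prod_lsa A B = \<lparr> lcarrier = lcarrier A \<times> lcarrier B, lzero = (lzero A, lzero B),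
     ladd = (\<lambda>z w. (ladd A (fst z) (fst w), ladd B (snd z) (snd w))),
     lneg = (\<lambda>z. (lneg A (fst z), lneg B (snd z))),
     lsmul = (\<lambda>a z. (lsmul A a (fst z), lsmul B a (snd z))),
     ldeg = (\<lambda>k. ldeg A k \<times> ldeg B k),
     lbr = (\<lambda>z w. (lbr A (fst z) (fst w), lbr B (snd z) (snd w))) \<rparr>"

lemma prod_lsa_simps [simp]:
  "lcarrier (prod_lsa A B) = lcarrier A \<times> lcarrier B" "lzero (prod_lsa A B) = (lzero A, lzero B)"
  "ladd (prod_lsa A B) z w = (ladd A (fst z) (fst w), ladd B (snd z) (snd w))"
  "lneg (prod_lsa A B) z = (lneg A (fst z), lneg B (snd z))"
  "lsmul (prod_lsa A B) a z = (lsmul A a (fst z), lsmul B a (snd z))"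
  "ldeg (prod_lsa A B) k = ldeg A k \<times> ldeg B k"
  "lbr (prod_lsa A B) z w = (lbr A (fst z) (fst w), lbr B (snd z) (snd w))"
  "sneg (prod_lsa A B) e z = (sneg A e (fst z), sneg B e (snd z))"
  by (simp_all add: prod_lsa_def sneg_def)

lemma lsum_prod_lsa:
  "lsum (prod_lsa A B) c ks = (lsum A (\<lambda>k. fst (c k)) ks, lsum B (\<lambda>k. snd (c k)) ks)"
  by (induction ks) simp_all

locale lie_superalg_pair = A: lie_superalg A + B: lie_superalg B
  for A :: "('k::field, 'a) lsa" and B :: "('k, 'b) lsa"
begin

lemma decomp_prod_iff:
  "decomp (prod_lsa A B) z c
    \<longleftrightarrow> decomp A (fst z) (\<lambda>k. fst (c k)) \<and> decomp B (snd z) (\<lambda>k. snd (c k))"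
proof
  assume "decomp (prod_lsa A B) z c"
  then show "decomp A (fst z) (\<lambda>k. fst (c k)) \<and> decomp B (snd z) (\<lambda>k. snd (c k))"
    unfolding decomp_def prod_lsa_simps lsum_prod_lsa by (metis fst_conv mem_Times_iff snd_conv)
next
  assume decomps: "decomp A (fst z) (\<lambda>k. fst (c k)) \<and> decomp B (snd z) (\<lambda>k. snd (c k))"
  then have "\<forall>\<^sub>F n in sequentially. (\<forall>k. k < - int n \<or> int n < k \<longrightarrow> fst (c k) = lzero A)
      \<and> fst z = lsum A (\<lambda>k. fst (c k)) [- int n..int n]"
    "\<forall>\<^sub>F n in sequentially. (\<forall>k. k < - int n \<or> int n < k \<longrightarrow> snd (c k) = lzero B)
      \<and> snd z = lsum B (\<lambda>k. snd (c k)) [- int n..int n]"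
    by (simp_all add: A.decomp_iff_eventually B.decomp_iff_eventually)
  then have "\<forall>\<^sub>F n in sequentially. (\<forall>k. k < - int n \<or> int n < k \<longrightarrow> c k = (lzero A, lzero B))
      \<and> z = lsum (prod_lsa A B) c [- int n..int n]"
    by eventually_elim (simp add: lsum_prod_lsa prod_eq_iff)
  then have "\<exists>n. (\<forall>k. k < - int n \<or> int n < k \<longrightarrow> c k = (lzero A, lzero B))
      \<and> z = lsum (prod_lsa A B) c [- int n..int n]"
    by (rule eventually_happens'[OF sequentially_bot])
  then show "decomp (prod_lsa A B) z c"
    using decomps by (auto simp: decomp_def mem_Times_iff)
qed

lemma graded_prod: "graded (prod_lsa A B)"
  unfolding graded_def
proof (intro conjI allI ballI)
  show "subspace (prod_lsa A B) (ldeg (prod_lsa A B) k)" for k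
    using A.deg_carrier B.deg_carrier
    by (auto simp: subspace_def A.deg_add A.deg_smul B.deg_add B.deg_smul)
  fix z assume "z \<in> lcarrier (prod_lsa A B)"
  then have "fst z \<in> lcarrier A" "snd z \<in> lcarrier B" by auto
  then have "decomp (prod_lsa A B) z (\<lambda>k. (comp A k (fst z), comp B k (snd z)))"
    by (simp add: decomp_prod_iff A.decomp_comp B.decomp_comp)
  moreover have "c = (\<lambda>k. (comp A k (fst z), comp B k (snd z)))"
    if "decomp (prod_lsa A B) z c" for c
    using that A.comp_eqI[of "fst z" "\<lambda>k. fst (c k)"] B.comp_eqI[of "snd z" "\<lambda>k. snd (c k)"]
    by (simp add: decomp_prod_iff fun_eq_iff prod_eq_iff)
  ultimately show "\<exists>!c. decomp (prod_lsa A B) z c" by blast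
qed

lemma lie_superalgebra_prod: "lie_superalgebra (prod_lsa A B)"
proof -
  have vs: "vs (prod_lsa A B)"
    by (auto simp: vs_def A.add_ac B.add_ac A.smul_add B.smul_add A.add_smul B.add_smul
        A.mul_smul B.mul_smul)
  have antisym: "lbr (prod_lsa A B) z w
      = lneg (prod_lsa A B) (sneg (prod_lsa A B) (odd i \<and> odd j) (lbr (prod_lsa A B) w z))"
    if "z \<in> ldeg (prod_lsa A B) i" "w \<in> ldeg (prod_lsa A B) j" for i j z w
    using that A.br_antisym_axiom[of "fst z" i "fst w" j] B.br_antisym_axiom[of "snd z" i "snd w" j]
    by (simp add: mem_Times_iff)
  have jacobi: "ladd (prod_lsa A B) (lbr (prod_lsa A B) z (lbr (prod_lsa A B) w v))
      (lneg (prod_lsa A B) (sneg (prod_lsa A B) (odd i \<and> odd j)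
        (lbr (prod_lsa A B) w (lbr (prod_lsa A B) z v))))
    = lbr (prod_lsa A B) (lbr (prod_lsa A B) z w) v"
    if "z \<in> ldeg (prod_lsa A B) i" "w \<in> ldeg (prod_lsa A B) j" "v \<in> lcarrier (prod_lsa A B)"
    for i j z w v
    using that A.br_jacobi_axiom[of "fst z" i "fst w" j "fst v"]
      B.br_jacobi_axiom[of "snd z" i "snd w" j "snd v"]
    by (simp add: mem_Times_iff)
  show ?thesis
    unfolding lie_superalgebra_def
    by (intro conjI ballI allI vs graded_prod)
      ((rule antisym, assumption, assumption) | (rule jacobi, assumption+)
        | simp add: mem_Times_iff A.br_add_left B.br_add_left A.br_add_right B.br_add_right
            A.br_smul_left B.br_smul_left A.br_smul_right B.br_smul_right A.br_deg B.br_deg)+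
qed

end

sublocale lie_superalg_pair \<subseteq> P: lie_superalg "prod_lsa A B"
  by (rule lie_superalg.intro[OF lie_superalgebra_prod])

context lie_superalg_pair
begin

lemma comp_prod: "z \<in> lcarrier (prod_lsa A B)
    \<Longrightarrow> comp (prod_lsa A B) k z = (comp A k (fst z), comp B k (snd z))"
  by (rule P.comp_eqI) (auto simp: decomp_prod_iff A.decomp_comp B.decomp_comp)

end

sublocale lie_superalg_pair \<subseteq> fst: lsa_epi "prod_lsa A B" A fst
  by unfold_locales (auto simp: comp_prod image_iff intro: B.deg_zero B.zero_closed)

sublocale lie_superalg_pair \<subseteq> snd: lsa_epi "prod_lsa A B" B snd
  by unfold_locales (auto simp: comp_prod image_iff intro: A.deg_zero A.zero_closed)

locale lsa_relation = lie_superalg_pair A B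
  for A :: "('k::field, 'a) lsa" and B :: "('k, 'b) lsa" +
  fixes R :: "('a \<times> 'b) set"
  assumes R: "subalgebra (prod_lsa A B) R"
begin

definition fibre :: "'b \<Rightarrow> 'a set" where
  "fibre x = {a. (a, x) \<in> R}"

lemma R_carrier:
  assumes "(a, x) \<in> R" shows "a \<in> lcarrier A" "x \<in> lcarrier B"
  using P.subspace_carrier[OF P.subalgebraD(2)[OF R] assms] by auto

lemma R_add: "(a, x) \<in> R \<Longrightarrow> (b, y) \<in> R \<Longrightarrow> (ladd A a b, ladd B x y) \<in> R"
  and R_smul: "(a, x) \<in> R \<Longrightarrow> (lsmul A c a, lsmul B c x) \<in> R"
  and R_br: "(a, x) \<in> R \<Longrightarrow> (b, y) \<in> R \<Longrightarrow> (lbr A a b, lbr B x y) \<in> R"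
  using P.subspace_add[OF P.subalgebraD(2)[OF R], of "(a, x)" "(b, y)"]
    P.subspace_smul[OF P.subalgebraD(2)[OF R], of "(a, x)" c]
    P.subalgebraD(4)[OF R, of "(a, x)" "(b, y)"]
  by simp_all

lemma R_comp: "(a, x) \<in> R \<Longrightarrow> (comp A k a, comp B k x) \<in> R"
  using P.subalgebraD(3)[OF R, of "(a, x)" k] R_carrier[of a x] by (simp add: comp_prod)

lemma R_sub: "(a, x) \<in> R \<Longrightarrow> (b, y) \<in> R \<Longrightarrow> (lsub A a b, lsub B x y) \<in> R"
  using R_add R_smul by blast

lemma ideal_fibre_zero: "ideal A (fst ` R) (fibre (lzero B))"
  unfolding ideal_def graded_subspace_def subspace_def fibre_def
proof (intro conjI ballI allI subsetI; clarsimp)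
  show "(lzero A, lzero B) \<in> R"
    using P.subspace_zero[OF P.subalgebraD(2)[OF R]] by simp
  show "a \<in> fst ` R" if "(a, lzero B) \<in> R" for a
    using that by force
  show "(lbr A s a, lzero B) \<in> R" if "(s, x) \<in> R" "(a, lzero B) \<in> R" for s x a
    using R_br[OF that] R_carrier[OF that(1)] by simp
qed (use R_carrier R_add[of _ "lzero B" _ "lzero B"] R_smul[of _ "lzero B"]
    R_comp[of _ "lzero B"] in auto)

lemma fibre_eq_coset:
  assumes a: "(a, x) \<in> R" shows "fibre x = coset A (fibre (lzero B)) a"
proof (intro equalityI subsetI)
  fix b assume "b \<in> fibre x"
  then have b: "(b, x) \<in> R" by (simp add: fibre_def)
  then have "lsub A b a \<in> fibre (lzero B)"
    using R_sub[OF b a] R_carrier[OF a] by (simp add: fibre_def)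
  then have "ladd A a (lsub A b a) \<in> coset A (fibre (lzero B)) a" unfolding coset_def by blast
  then show "b \<in> coset A (fibre (lzero B)) a" using R_carrier[OF a] R_carrier[OF b] by simp
next
  fix b assume "b \<in> coset A (fibre (lzero B)) a"
  then show "b \<in> fibre x" using R_add[OF a] R_carrier[OF a] by (force simp: coset_def fibre_def)
qed

end

sublocale lsa_relation \<subseteq> quot: lsa_quot A "fst ` R" "fibre (lzero B)"
  by unfold_locales (use fst.subalgebra_image[OF R] ideal_fibre_zero in auto)

locale lsa_relation_onto = lsa_relation +
  assumes surj: "snd ` R = lcarrier B"
begin

lemma obtain_preimage:
  assumes "x \<in> lcarrier B" obtains a where "(a, x) \<in> R"
  using assms surj by force

lemma fibre_hom: "lsa_hom B (quot A (fst ` R) (fibre (lzero B))) fibre"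
  unfolding lsa_hom_def
proof (intro conjI ballI allI subsetI)
  fix x assume "x \<in> lcarrier B"
  then obtain a where a: "(a, x) \<in> R" by (rule obtain_preimage)
  then have a_dom: "a \<in> fst ` R" by force
  show "fibre x \<in> lcarrier (quot A (fst ` R) (fibre (lzero B)))"
    using fibre_eq_coset[OF a] a_dom by simp
  show "fibre (lsmul B c x) = lsmul (quot A (fst ` R) (fibre (lzero B))) c (fibre x)" for c
    by (simp only: fibre_eq_coset[OF a] fibre_eq_coset[OF R_smul[OF a]] quot.quot_smul[OF a_dom])
  fix y assume "y \<in> lcarrier B"
  then obtain b where b: "(b, y) \<in> R" by (rule obtain_preimage)
  then have b_dom: "b \<in> fst ` R" by force
  show "fibre (ladd B x y) = ladd (quot A (fst ` R) (fibre (lzero B))) (fibre x) (fibre y)"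
    by (simp only: fibre_eq_coset[OF a] fibre_eq_coset[OF b] fibre_eq_coset[OF R_add[OF a b]]
        quot.quot_add[OF a_dom b_dom])
  show "fibre (lbr B x y) = lbr (quot A (fst ` R) (fibre (lzero B))) (fibre x) (fibre y)"
    by (simp only: fibre_eq_coset[OF a] fibre_eq_coset[OF b] fibre_eq_coset[OF R_br[OF a b]]
        quot.quot_br[OF a_dom b_dom])
next
  fix k X assume "X \<in> fibre ` ldeg B k"
  then obtain x where x: "x \<in> ldeg B k" "X = fibre x" by blast
  obtain a where a: "(a, x) \<in> R" using obtain_preimage[OF B.deg_carrier[OF x(1)]] .
  have comp_a: "(comp A k a, x) \<in> R" using R_comp[OF a, of k] B.comp_homogeneous[OF x(1)] by simp
  then have "comp A k a \<in> fst ` R \<inter> ldeg A k" using R_carrier[OF a] by force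
  then show "X \<in> ldeg (quot A (fst ` R) (fibre (lzero B))) k"
    using fibre_eq_coset[OF comp_a] by (simp add: x(2))
qed

lemma fibre_iso:
  assumes single_valued: "\<And>x. (lzero A, x) \<in> R \<Longrightarrow> x = lzero B"
  shows "lsa_iso B (quot A (fst ` R) (fibre (lzero B))) fibre"
  unfolding lsa_iso_def bij_betw_def
proof (intro conjI fibre_hom inj_onI equalityI subsetI)
  fix x y assume x: "x \<in> lcarrier B" and y: "y \<in> lcarrier B" and eq: "fibre x = fibre y"
  obtain a where a: "(a, x) \<in> R" using obtain_preimage[OF x] .
  then have "(a, y) \<in> R" using eq by (auto simp: fibre_def)
  then have "(lzero A, lsub B x y) \<in> R" using R_sub[OF a] R_carrier[OF a] by fastforce
  then show "x = y" using single_valued B.sub_eq_zero_iff[OF x y] by simp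
next
  fix X assume "X \<in> fibre ` lcarrier B"
  then show "X \<in> lcarrier (quot A (fst ` R) (fibre (lzero B)))"
    using fibre_hom by (auto simp: lsa_hom_def)
next
  fix X assume "X \<in> lcarrier (quot A (fst ` R) (fibre (lzero B)))"
  then obtain a x where a: "(a, x) \<in> R" and X: "X = coset A (fibre (lzero B)) a" by auto
  show "X \<in> fibre ` lcarrier B" unfolding X fibre_eq_coset[OF a, symmetric]
    using R_carrier[OF a] by blast
qed

end

section \<open>Prolongations\<close>

text \<open>The largest graded subspace on which \<open>V\<close> acts by brackets from the right and whose positive
  part is generated by \<open>V\<close>; in degree \<open>k \<le> 0\<close> it consists of all \<open>z\<close> with \<open>[z, V]\<close> in its part
  of degree \<open>k + 1\<close>.\<close>

coinductive_set prolongation :: "('k, 'a) lsa \<Rightarrow> 'a set \<Rightarrow> 'a set" for A V where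
  "z \<in> lcarrier A \<Longrightarrow> (\<And>k. 1 \<le> k \<Longrightarrow> comp A k z \<in> lie_span A V)
    \<Longrightarrow> (\<And>u. u \<in> V \<Longrightarrow> lbr A z u \<in> prolongation A V) \<Longrightarrow> z \<in> prolongation A V"

lemma prolongation_greatest:
  assumes "\<And>z. z \<in> Y \<Longrightarrow> z \<in> lcarrier A"
    and "\<And>z k. z \<in> Y \<Longrightarrow> 1 \<le> k \<Longrightarrow> comp A k z \<in> lie_span A V"
    and "\<And>z u. z \<in> Y \<Longrightarrow> u \<in> V \<Longrightarrow> lbr A z u \<in> Y"
  shows "Y \<subseteq> prolongation A V"
proof
  fix z assume "z \<in> Y"
  then show "z \<in> prolongation A V"
    by (coinduction arbitrary: z rule: prolongation.coinduct) (use assms in auto)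
qed

locale lie_prolongation = lie_superalg A for A :: "('k::field, 'a) lsa" +
  fixes V :: "'a set"
  assumes V_deg: "V \<subseteq> ldeg A 1"
begin

lemma V_carrier: "u \<in> V \<Longrightarrow> u \<in> lcarrier A"
  using V_deg deg_carrier by blast

lemma prolongation_carrier: "z \<in> prolongation A V \<Longrightarrow> z \<in> lcarrier A"
  and prolongation_comp_pos: "z \<in> prolongation A V \<Longrightarrow> 1 \<le> k \<Longrightarrow> comp A k z \<in> lie_span A V"
  and prolongation_br_V: "z \<in> prolongation A V \<Longrightarrow> u \<in> V \<Longrightarrow> lbr A z u \<in> prolongation A V"
  by (auto elim: prolongation.cases)

lemma subalgebra_lie_span_V: "subalgebra A (lie_span A V)"
  using V_deg by (intro subalgebra_lie_span) auto

lemma subspace_prolongation: "subspace A (prolongation A V)"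
proof -
  have "{lzero A} \<subseteq> prolongation A V"
    by (rule prolongation_greatest) (auto simp: V_carrier lie_span.zero)
  moreover have "{ladd A x y | x y. x \<in> prolongation A V \<and> y \<in> prolongation A V} \<subseteq> prolongation A V"
  proof (rule prolongation_greatest; clarsimp)
    fix x y u assume "x \<in> prolongation A V" "y \<in> prolongation A V" "u \<in> V"
    then show "\<exists>x' y'. lbr A (ladd A x y) u = ladd A x' y'
        \<and> x' \<in> prolongation A V \<and> y' \<in> prolongation A V"
      using prolongation_carrier prolongation_br_V V_carrier br_add_left by blast
  qed (simp_all add: prolongation_carrier prolongation_comp_pos lie_span.add)
  moreover have "{lsmul A a x | a x. x \<in> prolongation A V} \<subseteq> prolongation A V"
  proof (rule prolongation_greatest; clarsimp)
    fix a x u assume "x \<in> prolongation A V" "u \<in> V"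
    then show "\<exists>b y. lbr A (lsmul A a x) u = lsmul A b y \<and> y \<in> prolongation A V"
      using prolongation_carrier prolongation_br_V V_carrier br_smul_left by blast
  qed (simp_all add: prolongation_carrier prolongation_comp_pos lie_span.smul)
  ultimately show ?thesis
    unfolding subspace_def using prolongation_carrier by blast
qed

lemma graded_subspace_prolongation: "graded_subspace A (prolongation A V)"
proof -
  have "{comp A k x | k x. x \<in> prolongation A V} \<subseteq> prolongation A V"
  proof (rule prolongation_greatest; clarsimp)
    fix k x u assume x: "x \<in> prolongation A V" and u: "u \<in> V"
    then have "lbr A (comp A k x) u = comp A (k + 1) (lbr A x u)"
      using comp_br_left[of u 1 x k] V_deg prolongation_carrier by auto
    then show "\<exists>i y. lbr A (comp A k x) u = comp A i y \<and> y \<in> prolongation A V"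
      using prolongation_br_V[OF x u] by blast
  qed (simp_all add: prolongation_carrier prolongation_comp_pos lie_span.zero)
  then show ?thesis using subspace_prolongation by (auto simp: graded_subspace_def)
qed

lemma lie_span_subset_prolongation: "lie_span A V \<subseteq> prolongation A V"
  using subspace_carrier[OF subalgebraD(2)[OF subalgebra_lie_span_V]]
    subalgebraD(3)[OF subalgebra_lie_span_V]
  by (intro prolongation_greatest) (auto intro: lie_span.intros)

lemma prolongation_deg_pos: "z \<in> prolongation A V \<Longrightarrow> z \<in> ldeg A k \<Longrightarrow> 1 \<le> k \<Longrightarrow> z \<in> lie_span A V"
  using prolongation_comp_pos[of z k] comp_homogeneous[of z k k] by simp

lemma prolongation_deg_nonpos:
  assumes "z \<in> ldeg A k" "k \<le> 0" "\<And>u. u \<in> V \<Longrightarrow> lbr A z u \<in> prolongation A V"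
  shows "z \<in> prolongation A V"
  by (rule prolongation.intros)
    (use assms deg_carrier comp_homogeneous[OF assms(1)] in \<open>auto intro: lie_span.zero\<close>)

lemma prolongation_br_lie_span:
  assumes "z \<in> prolongation A V" "w \<in> lie_span A V" shows "lbr A z w \<in> prolongation A V"
proof -
  have "V \<subseteq> transporter A (prolongation A V) (prolongation A V)"
    by (auto simp: transporter_def V_carrier prolongation_br_V)
  then have "lie_span A V \<subseteq> transporter A (prolongation A V) (prolongation A V)"
    using graded_subspace_prolongation by (intro lie_span_least subalgebra_transporter) auto
  then show ?thesis using assms by (auto simp: transporter_def)
qed

lemma prolongation_br_homogeneous:
  assumes "x \<in> prolongation A V \<inter> ldeg A i" "y \<in> prolongation A V \<inter> ldeg A k"
  shows "lbr A x y \<in> prolongation A V"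
  using assms
proof (induction "nat (1 - (i + k))" arbitrary: i k x y rule: less_induct)
  case less
  note smul = subspace_smul[OF subspace_prolongation]
  have x: "x \<in> ldeg A i" and y: "y \<in> ldeg A k" using less.prems by auto
  consider (y_pos) "1 \<le> k" | (x_pos) "1 \<le> i" | (nonpos) "i \<le> 0" "k \<le> 0" by linarith
  then show ?case
  proof cases
    case y_pos
    then show ?thesis using less.prems prolongation_br_lie_span prolongation_deg_pos by blast
  next
    case x_pos
    then have "lbr A y x \<in> prolongation A V"
      using less.prems prolongation_br_lie_span prolongation_deg_pos by blast
    then show ?thesis using br_antisym[OF x y] smul by simp
  next
    case nonpos
    show ?thesis
    proof (rule prolongation_deg_nonpos[OF br_deg[OF x y]])
      show "i + k \<le> 0" using nonpos by simp
      fix u assume u: "u \<in> V"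
      then have u_deg: "u \<in> ldeg A 1" using V_deg by blast
      have "lbr A x u \<in> prolongation A V \<inter> ldeg A (i + 1)"
        "lbr A y u \<in> prolongation A V \<inter> ldeg A (k + 1)"
        using less.prems prolongation_br_V[OF _ u] br_deg[OF x u_deg] br_deg[OF y u_deg] by auto
      then have "lbr A x (lbr A y u) \<in> prolongation A V" "lbr A y (lbr A x u) \<in> prolongation A V"
        using less.hyps[of i "k + 1" x "lbr A y u"] less.hyps[of k "i + 1" y "lbr A x u"] less.prems
          nonpos by auto
      then show "lbr A (lbr A x y) u \<in> prolongation A V"
        using br_jacobi[OF x y V_carrier[OF u]] smul subspace_add[OF subspace_prolongation] by simp
    qed
  qed
qed

theorem subalgebra_prolongation: "subalgebra A (prolongation A V)"
  using graded_subspace_prolongation prolongation_br_homogeneous by (rule subalgebraI)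

lemma prolongation_kernel_trivial:
  assumes p: "lsa_epi A B p" and V: "subspace A V"
    and V_kernel: "\<And>u. u \<in> V \<Longrightarrow> p u = lzero B \<Longrightarrow> u = lzero A"
    and faithful: "\<And>z k. z \<in> ldeg A k \<Longrightarrow> k \<le> 0 \<Longrightarrow> p z = lzero B
      \<Longrightarrow> (\<And>u. u \<in> V \<Longrightarrow> lbr A z u = lzero A) \<Longrightarrow> z = lzero A"
    and "z \<in> prolongation A V" "z \<in> ldeg A k" "k \<le> 1" "p z = lzero B"
  shows "z = lzero A"
  using assms(5-)
proof (induction "nat (1 - k)" arbitrary: k z)
  case 0
  then have "z \<in> V"
    using prolongation_deg_pos[of z 1] lie_span_Int_deg_1[OF V V_deg] by auto
  then show ?case using V_kernel 0 by blast
next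
  case (Suc n)
  interpret p: lsa_epi A B p by fact
  have k: "k \<le> 0" "n = nat (1 - (k + 1))" using Suc.hyps(2) by auto
  show ?case
  proof (rule faithful[OF Suc.prems(2) k(1) Suc.prems(4)])
    fix u assume u: "u \<in> V"
    have "p (lbr A z u) = lzero B"
      using Suc.prems(4) p.image_br[of z u, symmetric] deg_carrier[OF Suc.prems(2)] V_carrier[OF u]
        p.image_carrier by simp
    moreover have "lbr A z u \<in> ldeg A (k + 1)" using br_deg[OF Suc.prems(2)] V_deg u by auto
    ultimately show "lbr A z u = lzero A"
      using Suc.hyps(1)[OF k(2) prolongation_br_V[OF Suc.prems(1) u]] k(1) by simp
  qed
qed

end

section \<open>Free positive parts\<close>

definition linear_on :: "('k, 'a) lsa \<Rightarrow> ('k, 'b) lsa \<Rightarrow> 'a set \<Rightarrow> ('a \<Rightarrow> 'b) \<Rightarrow> bool" where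
  "linear_on A B V f \<longleftrightarrow>
     (\<forall>x\<in>V. \<forall>y\<in>V. f (ladd A x y) = ladd B (f x) (f y)) \<and>
     (\<forall>a. \<forall>x\<in>V. f (lsmul A a x) = lsmul B a (f x))"

lemma linear_onD:
  assumes "linear_on A B V f" "x \<in> V"
  shows "y \<in> V \<Longrightarrow> f (ladd A x y) = ladd B (f x) (f y)"
    and "f (lsmul A a x) = lsmul B a (f x)"
  using assms by (auto simp: linear_on_def)

lemma linear_on_compose:
  assumes f: "linear_on A B V f" and g: "linear_on B C W g" and fV: "f ` V \<subseteq> W"
  shows "linear_on A C V (g \<circ> f)"
  using linear_onD[OF f] linear_onD[OF g] fV by (simp add: linear_on_def image_subset_iff)

lemma linear_on_inv_into:
  assumes f: "linear_on A B V f" and bij: "bij_betw f V W" and V: "subspace A V"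
  shows "linear_on B A W (inv_into V f)"
proof -
  have W: "W = f ` V" using bij by (simp add: bij_betw_def)
  have inv: "inv_into V f (f x) = x" if "x \<in> V" for x
    using bij that by (simp add: bij_betw_def)
  have V_closed: "ladd A x y \<in> V" "lsmul A a x \<in> V" if "x \<in> V" "y \<in> V" for x y a
    using V that by (auto simp: subspace_def)
  show ?thesis
    unfolding linear_on_def W
    by (auto simp: linear_onD[OF f, symmetric] inv V_closed)
qed

lemma lsa_hom_compose: "lsa_hom A B f \<Longrightarrow> lsa_hom B C g \<Longrightarrow> lsa_hom A C (g \<circ> f)"
  by (simp add: lsa_hom_def image_subset_iff)

lemma lsa_hom_substr: "subalgebra A S \<Longrightarrow> lsa_hom (substr A S) A (\<lambda>x. x)"
  by (auto simp: lsa_hom_def subalgebra_def graded_subspace_def subspace_def)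

lemma (in lie_superalg) lsa_hom_cong:
  assumes f: "lsa_hom A B f" and eq: "\<And>x. x \<in> lcarrier A \<Longrightarrow> g x = f x"
  shows "lsa_hom A B g"
  using f eq deg_carrier by (auto simp: lsa_hom_def image_subset_iff)

lemma (in lie_superalg_pair) subspace_linear_image:
  assumes f: "linear_on A B V f" and V: "subspace A V" and closed: "f ` V \<subseteq> lcarrier B"
  shows "subspace B (f ` V)"
proof -
  have "f (lzero A) = lzero B"
    using linear_onD(2)[OF f A.subspace_zero[OF V], of 0] closed A.subspace_zero[OF V] by auto
  then have "lzero B \<in> f ` V" using A.subspace_zero[OF V] by (metis imageI)
  moreover have "ladd B (f x) (f y) \<in> f ` V" "lsmul B a (f x) \<in> f ` V"
    if "x \<in> V" "y \<in> V" for x y a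
    using that A.subspace_add[OF V] A.subspace_smul[OF V]
    by (auto simp: linear_onD[OF f, symmetric])
  ultimately show ?thesis
    using closed by (auto simp: subspace_def)
qed

lemma (in lie_superalg_pair) lsa_hom_zero:
  assumes "lsa_hom A B f" shows "f (lzero A) = lzero B"
proof -
  have "f (lsmul A 0 (lzero A)) = lsmul B 0 (f (lzero A))" "f (lzero A) \<in> lcarrier B"
    using assms A.zero_closed unfolding lsa_hom_def by blast+
  then show ?thesis by simp
qed

lemma (in lsa_epi) inv_hom:
  assumes "inj_on f (lcarrier A)"
  shows "lsa_hom B A (inv_into (lcarrier A) f)"
proof -
  have "inv_into (lcarrier A) f (f x) = x" if "x \<in> lcarrier A" for x
    using assms that by simp
  then show ?thesis
    using A.deg_carrier by (auto simp: lsa_hom_def image_carrier image_deg image_add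
        image_smul image_br)
qed

lemma (in lie_superalg) free_posD:
  fixes L :: "('k, 'a) lsa"
  assumes "free_pos A" "lie_superalgebra L" "linear_on A L (ldeg A 1) f" "f ` ldeg A 1 \<subseteq> ldeg L 1"
  shows "\<exists>!h. h \<in> extensional (pos_part A) \<and> lsa_hom (substr A (pos_part A)) L h
    \<and> (\<forall>u\<in>ldeg A 1. h u = f u)"
  using assms(1)[unfolded free_pos_def, rule_format, OF assms(2), of f] assms(3,4)
  by (auto simp: linear_on_def)

lemma (in lie_superalg) free_pos_hom_unique:
  fixes L :: "('k, 'a) lsa"
  assumes free: "free_pos A" and L: "lie_superalgebra L"
    and h: "lsa_hom (substr A (pos_part A)) L h" and h': "lsa_hom (substr A (pos_part A)) L h'"
    and eq: "\<And>u. u \<in> ldeg A 1 \<Longrightarrow> h u = h' u" and w: "w \<in> pos_part A"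
  shows "h w = h' w"
proof -
  interpret pos: lie_superalg "substr A (pos_part A)"
    by (rule lie_superalg.intro[OF lie_superalgebra_substr[OF subalgebra_pos_part]])
  have deg_1: "ldeg A 1 \<subseteq> pos_part A" using part_deg by auto
  have "linear_on A L (ldeg A 1) h" "h ` ldeg A 1 \<subseteq> ldeg L 1"
    using h deg_1 by (auto simp: lsa_hom_def linear_on_def subset_iff image_subset_iff)
  note ex1 = free_posD[OF free L this]
  have restrict: "restrict g (pos_part A) \<in> extensional (pos_part A)
      \<and> lsa_hom (substr A (pos_part A)) L (restrict g (pos_part A))
      \<and> (\<forall>u\<in>ldeg A 1. restrict g (pos_part A) u = h u)"
    if "lsa_hom (substr A (pos_part A)) L g" "\<And>u. u \<in> ldeg A 1 \<Longrightarrow> g u = h u" for g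
    using pos.lsa_hom_cong[OF that(1), of "restrict g (pos_part A)"] that(2) deg_1 by auto
  have "restrict h (pos_part A) = restrict h' (pos_part A)"
    using ex1 restrict[OF h] restrict[OF h'] eq by (metis (no_types, lifting))
  then show ?thesis using w by (metis restrict_apply')
qed

lemma (in lie_superalg) free_pos_generated:
  assumes free: "free_pos A" shows "pos_generated A"
proof (rule pos_generatedI)
  let ?P = "lie_span A (ldeg A 1)"
  have P: "subalgebra A ?P" by (rule subalgebra_lie_span) auto
  have "linear_on A (substr A ?P) (ldeg A 1) (\<lambda>u. u)" by (simp add: linear_on_def)
  moreover have "(\<lambda>u. u) ` ldeg A 1 \<subseteq> ldeg (substr A ?P) 1" by (auto intro: lie_span.gen)
  ultimately obtain h where h: "lsa_hom (substr A (pos_part A)) (substr A ?P) h"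
      and h_gen: "\<forall>u\<in>ldeg A 1. h u = u"
    using ex1_implies_ex[OF free_posD[OF free lie_superalgebra_substr[OF P]]] by blast
  have "lsa_hom (substr A (pos_part A)) A h"
    using lsa_hom_compose[OF h lsa_hom_substr[OF P]] by (simp add: o_def)
  then have "h w = w" if "w \<in> pos_part A" for w
    using free_pos_hom_unique[OF free lie _ lsa_hom_substr[OF subalgebra_pos_part]] h_gen that
    by simp
  then show "pos_part A \<subseteq> ?P" using h by (force simp: lsa_hom_def)
qed

primrec lie_layer :: "('k, 'a) lsa \<Rightarrow> 'a set \<Rightarrow> nat \<Rightarrow> 'a set" where
  "lie_layer A X 0 = insert (lzero A) X"
| "lie_layer A X (Suc n) = lie_layer A X n \<union>
     (case_prod (ladd A) ` (lie_layer A X n \<times> lie_layer A X n) \<union>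
     (case_prod (lsmul A) ` (UNIV \<times> lie_layer A X n) \<union>
      case_prod (lbr A) ` (lie_layer A X n \<times> lie_layer A X n)))"

lemma lie_layer_mono: "m \<le> n \<Longrightarrow> lie_layer A X m \<subseteq> lie_layer A X n"
  by (rule lift_Suc_mono_le) auto

lemma lie_span_subset_layers: "lie_span A X \<subseteq> (\<Union>n. lie_layer A X n)"
proof
  have common_layer: "\<exists>n. x \<in> lie_layer A X n \<and> y \<in> lie_layer A X n"
    if "x \<in> lie_layer A X m" "y \<in> lie_layer A X m'" for x y m m'
    using that lie_layer_mono[of m "max m m'" A X] lie_layer_mono[of m' "max m m'" A X] by auto
  fix x assume "x \<in> lie_span A X"
  then have "\<exists>n. x \<in> lie_layer A X n"
  proof (induction rule: lie_span.induct)
    case (gen x)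
    then have "x \<in> lie_layer A X 0" by simp
    then show ?case by blast
  next
    case zero
    have "lzero A \<in> lie_layer A X 0" by simp
    then show ?case by blast
  next
    case (add x y)
    then obtain n where "x \<in> lie_layer A X n" "y \<in> lie_layer A X n" using common_layer by blast
    then have "ladd A x y \<in> lie_layer A X (Suc n)" by force
    then show ?case by blast
  next
    case (smul x a)
    then obtain n where "x \<in> lie_layer A X n" by blast
    then have "lsmul A a x \<in> lie_layer A X (Suc n)" by force
    then show ?case by blast
  next
    case (br x y)
    then obtain n where "x \<in> lie_layer A X n" "y \<in> lie_layer A X n" using common_layer by blast
    then have "lbr A x y \<in> lie_layer A X (Suc n)" by force
    then show ?case by blast
  qed
  then show "x \<in> (\<Union>n. lie_layer A X n)" by blast
qed

lemma card_lie_span_infinite: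
  includes cardinal_syntax
  fixes A :: "('k, 'a) lsa"
  assumes inf: "infinite X" and K: "|UNIV :: 'k set| \<le>o |X|"
  shows "|lie_span A X| \<le>o |X|"
proof -
  have Un: "|B \<union> C| \<le>o |X|" if "|B| \<le>o |X|" "|C| \<le>o |X|" for B C :: "'a set"
    by (rule card_of_Un_ordLeq_infinite_Field[OF _ that card_of_Card_order])
      (simp add: inf Field_card_of)
  have "|lie_layer A X n| \<le>o |X|" for n
  proof (induction n)
    case 0
    have "|{lzero A} \<union> X| \<le>o |X|"
      using inf by (intro Un card_of_singl_ordLeq card_of_mono1) auto
    then show ?case by simp
  next
    case (Suc n)
    have image: "|f ` (B \<times> lie_layer A X n)| \<le>o |X|" if "|B| \<le>o |X|" for f :: "'b \<times> 'a \<Rightarrow> 'a" and B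
      by (rule ordLeq_transitive[OF card_of_image card_of_Sigma_ordLeq_infinite[OF inf that]])
        (simp add: Suc)
    show ?case unfolding lie_layer.simps by (intro Un Suc image K)
  qed
  then have "|\<Union>n. lie_layer A X n| \<le>o |X|"
    using inf by (intro card_of_UNION_ordLeq_infinite) (auto simp: infinite_iff_card_of_nat)
  then show ?thesis
    using card_of_mono1[OF lie_span_subset_layers] ordLeq_transitive by blast
qed

lemma (in graded_vs) inj_smul:
  assumes x: "x \<in> lcarrier A" "x \<noteq> lzero A" shows "inj (\<lambda>a. lsmul A a x)"
proof (rule injI)
  fix a b assume eq: "lsmul A a x = lsmul A b x"
  have "lsmul A (a - b) x = ladd A (lsmul A a x) (lsmul A (- b) x)"
    using add_smul[OF x(1), of a "- b"] by simp
  also have "\<dots> = lsmul A (b + - b) x" using x(1) by (simp only: eq add_smul)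
  finally have "lsmul A (a - b) x = lzero A" using x(1) by simp
  then show "a = b" using smul_eq_zeroD[OF x(1)] x(2) by force
qed

lemma (in lie_superalg) card_lie_span_subspace:
  includes cardinal_syntax
  assumes K: "infinite (UNIV :: 'k set)" and X: "subspace A X"
  shows "|lie_span A X| \<le>o |X|"
proof (cases "X = {lzero A}")
  case True
  have "x \<in> X" if "x \<in> lie_span A X" for x
    using that by induction (use True in auto)
  then show ?thesis by (intro card_of_mono1 subsetI)
next
  case False
  then obtain x where x: "x \<in> X" "x \<noteq> lzero A" using subspace_zero[OF X] by blast
  have inj: "inj (\<lambda>a. lsmul A a x)" using inj_smul subspace_carrier[OF X x(1)] x(2) .
  have range: "range (\<lambda>a. lsmul A a x) \<subseteq> X" using subspace_smul[OF X x(1)] by blast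
  have "|UNIV :: 'k set| \<le>o |X|" using inj range card_of_ordLeq by blast
  moreover have "infinite X" using infinite_super[OF range] finite_image_iff[OF inj] K by simp
  ultimately show ?thesis by (intro card_lie_span_infinite)
qed

definition transport :: "('k, 'a) lsa \<Rightarrow> ('a \<Rightarrow> 'b) \<Rightarrow> ('k, 'b) lsa" where
  "transport A i = (let r = inv_into (lcarrier A) i in
     \<lparr> lcarrier = i ` lcarrier A, lzero = i (lzero A),
       ladd = (\<lambda>x y. i (ladd A (r x) (r y))), lneg = (\<lambda>x. i (lneg A (r x))),
       lsmul = (\<lambda>a x. i (lsmul A a (r x))), ldeg = (\<lambda>k. i ` ldeg A k),
       lbr = (\<lambda>x y. i (lbr A (r x) (r y))) \<rparr>)"

lemma (in lie_superalg) transport_epi: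
  assumes "inj_on i (lcarrier A)"
  shows "lsa_epi A (transport A i) i"
proof unfold_locales
  fix x k assume "x \<in> lcarrier A" "i x = i (lzero A)"
  then have "x = lzero A" using assms by (simp add: inj_on_eq_iff)
  then show "i (comp A k x) = i (lzero A)" by simp
qed (simp_all add: transport_def Let_def assms)

text \<open>The universal property only quantifies over structures on the type of \<open>A\<close>. It extends to all
  others because the subalgebra generated by the image of the degree-1 space is no larger than that
  space, hence isomorphic to a structure on the type of \<open>A\<close>.\<close>

theorem (in lie_superalg_pair) free_pos_lift:
  assumes K: "infinite (UNIV :: 'k set)" and free: "free_pos A"
    and f: "linear_on A B (ldeg A 1) f" and f_deg: "f ` ldeg A 1 \<subseteq> ldeg B 1"
  shows "\<exists>h. lsa_hom (substr A (pos_part A)) B h \<and> (\<forall>u\<in>ldeg A 1. h u = f u)"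
proof -
  include cardinal_syntax
  let ?M = "lie_span B (f ` ldeg A 1)"
  have M: "subalgebra B ?M" using f_deg by (intro B.subalgebra_lie_span) auto
  have "subspace B (f ` ldeg A 1)"
    using f A.subspace_deg f_deg B.deg_carrier by (intro subspace_linear_image) auto
  then have "|?M| \<le>o |f ` ldeg A 1|" by (rule B.card_lie_span_subspace[OF K])
  also have "|f ` ldeg A 1| \<le>o |UNIV :: 'a set|"
    by (rule ordLeq_transitive[OF card_of_image card_of_mono1[OF subset_UNIV]])
  finally obtain i :: "'b \<Rightarrow> 'a" where i: "inj_on i ?M"
    using card_of_ordLeq by metis
  interpret M: lie_superalg "substr B ?M"
    by (rule lie_superalg.intro[OF B.lie_superalgebra_substr[OF M]])
  interpret L: lsa_epi "substr B ?M" "transport (substr B ?M) i" i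
    by (rule M.transport_epi) (simp add: i)
  have gen: "f u \<in> ?M" if "u \<in> ldeg A 1" for u using that by (auto intro: lie_span.gen)
  have "linear_on (substr B ?M) (transport (substr B ?M) i) ?M i"
    by (simp add: linear_on_def L.image_add L.image_smul)
  then have "linear_on A (transport (substr B ?M) i) (ldeg A 1) (i \<circ> f)"
    using f gen by (intro linear_on_compose[where B = "substr B ?M" and W = ?M])
      (auto simp: linear_on_def)
  moreover have "(i \<circ> f) ` ldeg A 1 \<subseteq> ldeg (transport (substr B ?M) i) 1"
    using gen f_deg by (auto simp: L.image_deg)
  ultimately obtain h where h: "lsa_hom (substr A (pos_part A)) (transport (substr B ?M) i) h"
      "\<And>u. u \<in> ldeg A 1 \<Longrightarrow> h u = i (f u)"
    using A.free_posD[OF free L.lie_superalgebra_image] by force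
  have "lsa_hom (substr A (pos_part A)) B ((\<lambda>x. x) \<circ> (inv_into ?M i \<circ> h))"
    using L.inv_hom i
    by (intro lsa_hom_compose[OF lsa_hom_compose[OF h(1)] lsa_hom_substr[OF M]]) simp
  moreover have "((\<lambda>x. x) \<circ> (inv_into ?M i \<circ> h)) u = f u" if "u \<in> ldeg A 1" for u
    using h(2) gen i that by simp
  ultimately show ?thesis by blast
qed

section \<open>The universal Lie superalgebra\<close>

lemma (in lie_superalg_pair) lie_span_subset_graph:
  assumes S: "subalgebra A S" and h: "lsa_hom (substr A S) B h" and X: "X \<subseteq> (\<lambda>a. (a, h a)) ` S"
  shows "lie_span (prod_lsa A B) X \<subseteq> (\<lambda>a. (a, h a)) ` S"
proof
  note sub = A.subalgebraD(2)[OF S]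
  have h_zero: "h (lzero A) = lzero B"
    using lie_superalg_pair.lsa_hom_zero[of "substr A S" B h] h A.lie_superalgebra_substr[OF S]
      B.lie_superalg_axioms
    by (simp add: lie_superalg_pair_def lie_superalg_def)
  fix z assume "z \<in> lie_span (prod_lsa A B) X"
  then show "z \<in> (\<lambda>a. (a, h a)) ` S"
  proof induction
    case (gen z)
    then show ?case using X by blast
  qed (use h A.subspace_zero[OF sub] A.subspace_add[OF sub] A.subspace_smul[OF sub]
      A.subalgebraD(4)[OF S] in \<open>auto simp: h_zero lsa_hom_def image_iff\<close>)
qed

locale universal_lie_superalg = U: lie_superalg U + G: lie_superalg G
  for U :: "('k::field, 'u) lsa" and G :: "('k, 'g) lsa" +
  fixes j :: "'g \<Rightarrow> 'u"
  assumes universal: "universal_lsa G U j"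

sublocale universal_lie_superalg \<subseteq> lie_superalg_pair U G ..

context universal_lie_superalg
begin

lemma free_pos_U: "free_pos U"
  and j_bij: "bij_betw j (ldeg G 1) (ldeg U 1)"
  and j_linear: "linear_on G U (ldeg G 1) j"
  and nonpos_representation: "k \<le> 0 \<Longrightarrow> bij_betw (\<lambda>x. restrict (\<lambda>u. lbr U x u) (ldeg U 1))
      (ldeg U k) (linmaps U (ldeg U 1) (ldeg U (k + 1)))"
  using universal by (auto simp: universal_lsa_def linear_on_def)

lemma pos_generated_U: "pos_generated U"
  by (rule U.free_pos_generated[OF free_pos_U])

lemma j_image: "j ` ldeg G 1 = ldeg U 1"
  using j_bij by (simp add: bij_betw_def)

lemma deg_1_transitive_U: "deg_1_transitive U"
  unfolding deg_1_transitive_def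
proof (intro allI impI ballI)
  fix k x assume k: "k \<le> 0" and x: "x \<in> ldeg U k"
    and central: "\<forall>u\<in>ldeg U 1. lbr U x u = lzero U"
  have "restrict (\<lambda>u. lbr U x u) (ldeg U 1) = restrict (\<lambda>u. lbr U (lzero U) u) (ldeg U 1)"
    using central U.deg_carrier by (intro restrict_ext) simp
  then show "x = lzero U"
    by (rule inj_onD[OF bij_betw_imp_inj_on[OF nonpos_representation[OF k]] _ x U.deg_zero])
qed

lemma ex_nonpos_representing:
  assumes k: "k \<le> 0" and g: "linear_on G U (ldeg G 1) g" and g_deg: "g ` ldeg G 1 \<subseteq> ldeg U (k + 1)"
  shows "\<exists>a\<in>ldeg U k. \<forall>u\<in>ldeg G 1. lbr U a (j u) = g u"
proof -
  let ?i = "inv_into (ldeg G 1) j"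
  have i_j: "?i (j u) = u" if "u \<in> ldeg G 1" for u
    using that bij_betw_inv_into_left[OF j_bij] by blast
  have "linear_on U U (ldeg U 1) (g \<circ> ?i)"
    by (rule linear_on_compose[OF linear_on_inv_into[OF j_linear j_bij G.subspace_deg] g])
      (auto simp: i_j simp flip: j_image)
  moreover have "(g \<circ> ?i) v \<in> ldeg U (k + 1)" if "v \<in> ldeg U 1" for v
    using that g_deg i_j by (auto simp flip: j_image)
  ultimately have "restrict (g \<circ> ?i) (ldeg U 1) \<in> linmaps U (ldeg U 1) (ldeg U (k + 1))"
    by (auto simp: linmaps_def linear_on_def U.deg_add U.deg_smul)
  then obtain a where a: "a \<in> ldeg U k"
      "restrict (g \<circ> ?i) (ldeg U 1) = restrict (\<lambda>u. lbr U a u) (ldeg U 1)"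
    using bij_betw_imp_surj_on[OF nonpos_representation[OF k]] by auto
  have "lbr U a (j u) = g u" if "u \<in> ldeg G 1" for u
    using fun_cong[OF a(2), of "j u"] that i_j[OF that] by (auto simp flip: j_image)
  then show ?thesis using a(1) by blast
qed

lemma
  assumes S: "subalgebra U S" and pos: "pos_part U \<subseteq> S"
    and D: "ideal U S D" "D \<subseteq> part U (\<lambda>k. 2 \<le> k)"
  shows lie_superalgebra_quot: "lie_superalgebra (quot U S D)"
    and pos_0_transitive_quot: "pos_0_transitive (quot U S D)"
    and pos_generated_quot: "pos_generated (quot U S D)"
proof -
  interpret quot: lsa_quot U S D by unfold_locales (fact S D(1))+
  show "lie_superalgebra (quot U S D)" by (rule quot.coset.lie_superalgebra_image)
  show "pos_0_transitive (quot U S D)"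
    using quot.deg_1_transitive_quot[OF deg_1_transitive_U pos D(2)]
    by (rule quot.coset.B.pos_0_transitive_if_deg_1_transitive)
  show "pos_generated (quot U S D)"
    using U.pos_generated_substr[OF pos_generated_U U.subalgebraD(1)[OF S] pos]
    by (rule quot.coset.pos_generated_image)
qed

definition graph :: "('u \<times> 'g) set" where
  "graph = (\<lambda>u. (j u, u)) ` ldeg G 1"

lemma graph_deg: "graph \<subseteq> ldeg (prod_lsa U G) 1"
  using j_image by (auto simp: graph_def)

lemma graph_carrier: "graph \<subseteq> lcarrier (prod_lsa U G)"
  using graph_deg P.deg_carrier by blast

lemma subspace_graph: "subspace (prod_lsa U G) graph"
proof -
  interpret swapped: lie_superalg_pair G "prod_lsa U G" ..
  have "linear_on G (prod_lsa U G) (ldeg G 1) (\<lambda>u. (j u, u))"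
    using linear_onD[OF j_linear] by (simp add: linear_on_def)
  then show ?thesis
    unfolding graph_def using graph_deg P.deg_carrier[of _ 1]
    by (intro swapped.subspace_linear_image G.subspace_deg) (auto simp: graph_def)
qed

end

sublocale universal_lie_superalg \<subseteq> prolong: lie_prolongation "prod_lsa U G" graph
  by unfold_locales (rule graph_deg)

abbreviation (in universal_lie_superalg) "prolonged_graph \<equiv> prolongation (prod_lsa U G) graph"

sublocale universal_lie_superalg \<subseteq> rel: lsa_relation U G prolonged_graph
  by unfold_locales (rule prolong.subalgebra_prolongation)

context universal_lie_superalg
begin

lemma j_zero: "j (lzero G) = lzero U"
  using P.subspace_zero[OF subspace_graph] by (auto simp: graph_def)

lemma fst_zero_if_snd_zero_below_deg_2:
  assumes "(a, lzero G) \<in> prolonged_graph" "a \<in> ldeg U k" "k \<le> 1"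
  shows "a = lzero U"
proof -
  have "(a, lzero G) = lzero (prod_lsa U G)"
  proof (rule prolong.prolongation_kernel_trivial[OF snd.lsa_epi_axioms subspace_graph])
    fix z i
    assume z: "z \<in> ldeg (prod_lsa U G) i" "snd z = lzero G" and i: "i \<le> 0"
      and central: "\<And>w. w \<in> graph \<Longrightarrow> lbr (prod_lsa U G) z w = lzero (prod_lsa U G)"
    have "lbr U (fst z) (j u) = lzero U" if "u \<in> ldeg G 1" for u
      using central[of "(j u, u)"] that by (simp add: graph_def)
    then have "\<forall>v\<in>ldeg U 1. lbr U (fst z) v = lzero U" by (simp flip: j_image)
    then have "fst z = lzero U" using deg_1_transitive_U z i by (auto simp: deg_1_transitive_def)
    then show "z = lzero (prod_lsa U G)" using z by (simp add: prod_eq_iff)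
  qed (use assms in \<open>auto simp: graph_def j_zero\<close>)
  then show ?thesis by simp
qed

lemma snd_zero_if_fst_zero_below_deg_2:
  assumes trans: "deg_1_transitive G" and "(lzero U, x) \<in> prolonged_graph" "x \<in> ldeg G k" "k \<le> 1"
  shows "x = lzero G"
proof -
  have "(lzero U, x) = lzero (prod_lsa U G)"
  proof (rule prolong.prolongation_kernel_trivial[OF fst.lsa_epi_axioms subspace_graph])
    fix z assume "z \<in> graph" "fst z = lzero U"
    then obtain u where "u \<in> ldeg G 1" "z = (j u, u)" "j u = j (lzero G)"
      by (auto simp: graph_def j_zero)
    then show "z = lzero (prod_lsa U G)"
      using inj_onD[OF bij_betw_imp_inj_on[OF j_bij], of u "lzero G"] j_zero by simp
  next
    fix z i
    assume z: "z \<in> ldeg (prod_lsa U G) i" "fst z = lzero U" and i: "i \<le> 0"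
      and central: "\<And>w. w \<in> graph \<Longrightarrow> lbr (prod_lsa U G) z w = lzero (prod_lsa U G)"
    have "lbr G (snd z) u = lzero G" if "u \<in> ldeg G 1" for u
      using central[of "(j u, u)"] that by (simp add: graph_def)
    then have "snd z = lzero G" using trans z i by (auto simp: deg_1_transitive_def)
    then show "z = lzero (prod_lsa U G)" using z by (simp add: prod_eq_iff)
  qed (use assms in auto)
  then show ?thesis by simp
qed

lemma fst_unique_below_deg_2:
  assumes "(a, x) \<in> prolonged_graph" "(b, x) \<in> prolonged_graph"
    and "a \<in> ldeg U k" "b \<in> ldeg U k" "k \<le> 1"
  shows "a = b"
proof -
  have "(lsub U a b, lzero G) \<in> prolonged_graph"
    using rel.R_sub[OF assms(1,2)] rel.R_carrier[OF assms(1)] by simp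
  moreover have "lsub U a b \<in> ldeg U k" using assms(3,4) by (simp add: U.deg_add U.deg_smul)
  ultimately show ?thesis
    using fst_zero_if_snd_zero_below_deg_2[of "lsub U a b" k] assms
      U.sub_eq_zero_iff[of a b] U.deg_carrier by blast
qed

lemma linear_on_if_related_to_br:
  assumes x: "x \<in> ldeg G k" and k: "k \<le> 0" and g_deg: "\<And>u. u \<in> ldeg G 1 \<Longrightarrow> g u \<in> ldeg U (k + 1)"
    and related: "\<And>u. u \<in> ldeg G 1 \<Longrightarrow> (g u, lbr G x u) \<in> prolonged_graph"
  shows "linear_on G U (ldeg G 1) g"
proof -
  have g_eqI: "g u = b"
    if "u \<in> ldeg G 1" "b \<in> ldeg U (k + 1)" "(b, lbr G x u) \<in> prolonged_graph" for u b
    using fst_unique_below_deg_2[OF related that(3) g_deg that(2)] that(1) k by simp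
  have x_carrier: "x \<in> lcarrier G" using x G.deg_carrier by blast
  have "g (ladd G u v) = ladd U (g u) (g v)" if u: "u \<in> ldeg G 1" and v: "v \<in> ldeg G 1" for u v
  proof (rule g_eqI)
    show "(ladd U (g u) (g v), lbr G x (ladd G u v)) \<in> prolonged_graph"
      using rel.R_add[OF related[OF u] related[OF v]] x_carrier G.deg_carrier[OF u]
        G.deg_carrier[OF v]
      by (simp add: G.br_add_right)
  qed (use u v g_deg G.deg_add U.deg_add in auto)
  moreover have "g (lsmul G c u) = lsmul U c (g u)" if u: "u \<in> ldeg G 1" for c u
  proof (rule g_eqI)
    show "(lsmul U c (g u), lbr G x (lsmul G c u)) \<in> prolonged_graph"
      using rel.R_smul[OF related[OF u]] x_carrier G.deg_carrier[OF u]
      by (simp add: G.br_smul_right)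
  qed (use u g_deg G.deg_smul U.deg_smul in auto)
  ultimately show ?thesis by (simp add: linear_on_def)
qed

lemma ex_fst_below_deg_2:
  assumes "k \<le> 1" "x \<in> ldeg G k"
  shows "\<exists>a\<in>ldeg U k. (a, x) \<in> prolonged_graph"
  using assms
proof (induction "nat (1 - k)" arbitrary: k x)
  case 0
  then have x: "x \<in> ldeg G 1" "k = 1" by auto
  then have "(j x, x) \<in> prolonged_graph"
    using prolong.lie_span_subset_prolongation by (auto simp: graph_def intro: lie_span.gen)
  then show ?case using x j_image by blast
next
  case (Suc n)
  then have k: "k \<le> 0" "n = nat (1 - (k + 1))" by auto
  have "\<forall>u\<in>ldeg G 1. \<exists>b. b \<in> ldeg U (k + 1) \<and> (b, lbr G x u) \<in> prolonged_graph"
    using Suc.hyps(1)[OF k(2) _ G.br_deg[OF Suc.prems(2)]] k(1) by auto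
  then obtain g where g: "\<And>u. u \<in> ldeg G 1 \<Longrightarrow> g u \<in> ldeg U (k + 1)"
      "\<And>u. u \<in> ldeg G 1 \<Longrightarrow> (g u, lbr G x u) \<in> prolonged_graph"
    by metis
  then obtain a where a: "a \<in> ldeg U k" "\<forall>u\<in>ldeg G 1. lbr U a (j u) = g u"
    using ex_nonpos_representing[OF k(1) linear_on_if_related_to_br[OF Suc.prems(2) k(1) g]]
    by blast
  have "(a, x) \<in> prolonged_graph"
    by (rule prolong.prolongation_deg_nonpos[of _ k])
      (use a g k(1) Suc.prems(2) in \<open>auto simp: graph_def\<close>)
  then show ?case using a(1) by blast
qed

lemma pos_part_subset_fst_prolonged_graph: "pos_part U \<subseteq> fst ` prolonged_graph"
proof -
  have "fst ` graph = ldeg U 1" using j_image by (auto simp: graph_def image_image)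
  then have "lie_span U (ldeg U 1) = fst ` lie_span (prod_lsa U G) graph"
    using fst.lie_span_image[OF graph_carrier] by simp
  then show ?thesis
    using pos_generated_U image_mono[OF prolong.lie_span_subset_prolongation, of fst]
    by (simp add: pos_generated_def)
qed

lemma fibre_zero_subset_part: "rel.fibre (lzero G) \<subseteq> part U (\<lambda>k. 2 \<le> k)"
proof
  fix a assume "a \<in> rel.fibre (lzero G)"
  then have a: "(a, lzero G) \<in> prolonged_graph" by (simp add: rel.fibre_def)
  have "comp U k a = lzero U" if "k < 2" for k
    using fst_zero_if_snd_zero_below_deg_2[of "comp U k a" k] rel.R_comp[OF a]
      rel.R_carrier[OF a] that by simp
  then show "a \<in> part U (\<lambda>k. 2 \<le> k)" using rel.R_carrier[OF a] by (simp add: part_def)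
qed

lemma snd_prolonged_graph:
  assumes gen: "pos_generated G" shows "snd ` prolonged_graph = lcarrier G"
proof (intro equalityI subsetI)
  show "x \<in> lcarrier G" if "x \<in> snd ` prolonged_graph" for x using that rel.R_carrier by auto
  have sub: "subspace G (snd ` prolonged_graph)"
    using snd.subspace_image prolong.subspace_prolongation by blast
  have "snd ` graph = ldeg G 1" by (auto simp: graph_def image_image)
  then have "lie_span G (ldeg G 1) = snd ` lie_span (prod_lsa U G) graph"
    using snd.lie_span_image[OF graph_carrier] by simp
  then have pos: "pos_part G \<subseteq> snd ` prolonged_graph"
    using gen image_mono[OF prolong.lie_span_subset_prolongation, of snd]
    by (simp add: pos_generated_def)
  fix x assume x: "x \<in> lcarrier G"
  have "comp G k x \<in> snd ` prolonged_graph" for k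
  proof (cases "k \<le> 1")
    case True
    then show ?thesis using ex_fst_below_deg_2[OF True G.comp_deg[OF x]] by force
  next
    case False
    then show ?thesis using pos G.part_deg[OF G.comp_deg[OF x], of "\<lambda>k. 1 \<le> k" k] by auto
  qed
  then show "x \<in> snd ` prolonged_graph" by (rule G.subspace_by_comps[OF sub x])
qed

lemma lie_span_graph_snd_zero_if_fst_zero:
  assumes K: "infinite (UNIV :: 'k set)" and x: "(lzero U, x) \<in> lie_span (prod_lsa U G) graph"
  shows "x = lzero G"
proof -
  have "linear_on U G (ldeg U 1) (inv_into (ldeg G 1) j)"
    by (rule linear_on_inv_into[OF j_linear j_bij G.subspace_deg])
  moreover have "inv_into (ldeg G 1) j ` ldeg U 1 \<subseteq> ldeg G 1"
    using j_image by (auto intro: inv_into_into)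
  ultimately obtain \<psi> where \<psi>: "lsa_hom (substr U (pos_part U)) G \<psi>"
      "\<forall>v\<in>ldeg U 1. \<psi> v = inv_into (ldeg G 1) j v"
    using free_pos_lift[OF K free_pos_U] by blast
  have "\<psi> (j u) = u" "j u \<in> pos_part U" if "u \<in> ldeg G 1" for u
    using \<psi>(2) bij_betw_inv_into_left[OF j_bij that] bij_betwE[OF j_bij] that U.part_deg[of "j u" 1]
    by auto
  then have "graph \<subseteq> (\<lambda>a. (a, \<psi> a)) ` pos_part U" by (force simp: graph_def)
  then have graph_\<psi>: "lie_span (prod_lsa U G) graph \<subseteq> (\<lambda>a. (a, \<psi> a)) ` pos_part U"
    by (rule lie_span_subset_graph[OF U.subalgebra_pos_part \<psi>(1)])
  then have "x = \<psi> (lzero U)" using x by auto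
  moreover have "lzero G = \<psi> (lzero U)"
    using graph_\<psi> lie_span.zero[of "prod_lsa U G" graph] by auto
  ultimately show ?thesis by simp
qed

lemma snd_zero_if_fst_zero:
  assumes K: "infinite (UNIV :: 'k set)" and trans: "deg_1_transitive G"
    and x: "(lzero U, x) \<in> prolonged_graph"
  shows "x = lzero G"
proof -
  have x_carrier: "x \<in> lcarrier G" using rel.R_carrier[OF x] by blast
  have "comp G k x = lzero G" for k
  proof -
    have comp_x: "(lzero U, comp G k x) \<in> prolonged_graph" using rel.R_comp[OF x, of k] by simp
    show ?thesis
    proof (cases "k \<le> 1")
      case True
      then show ?thesis
        using snd_zero_if_fst_zero_below_deg_2[OF trans comp_x G.comp_deg[OF x_carrier]] by blast
    next
      case False
      then have "(lzero U, comp G k x) \<in> lie_span (prod_lsa U G) graph"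
        using comp_x G.comp_deg[OF x_carrier] by (intro prolong.prolongation_deg_pos[of _ k]) auto
      then show ?thesis by (rule lie_span_graph_snd_zero_if_fst_zero[OF K])
    qed
  qed
  then show ?thesis using G.subspace_by_comps[OF G.subspace_singleton_zero x_carrier] by simp
qed

theorem ex_quotient_presentation:
  assumes K: "infinite (UNIV :: 'k set)" and trans: "pos_0_transitive G" and gen: "pos_generated G"
  shows "\<exists>T D. T \<subseteq> part U (\<lambda>k. k \<le> 0) \<and> subspace U T
    \<and> subalgebra U (dsum U T (pos_part U)) \<and> ideal U (dsum U T (pos_part U)) D
    \<and> D \<subseteq> part U (\<lambda>k. 2 \<le> k) \<and> (\<exists>f. lsa_iso G (quot U (dsum U T (pos_part U)) D) f)"
proof -
  interpret rel: lsa_relation_onto U G prolonged_graph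
    by unfold_locales (rule snd_prolonged_graph[OF gen])
  let ?T = "fst ` prolonged_graph \<inter> part U (\<lambda>k. k \<le> 0)"
  have domain: "subalgebra U (fst ` prolonged_graph)"
    by (rule fst.subalgebra_image[OF prolong.subalgebra_prolongation])
  have "subspace U ?T"
    using U.subalgebraD(2)[OF domain] U.graded_subspace_part
    by (intro U.subspace_Int) (simp_all add: graded_subspace_def)
  moreover have "dsum U ?T (pos_part U) = fst ` prolonged_graph"
    using U.subalgebraD(1)[OF domain] pos_part_subset_fst_prolonged_graph
    by (rule U.dsum_nonpos_pos_part)
  moreover have "lsa_iso G (quot U (fst ` prolonged_graph) (rel.fibre (lzero G))) rel.fibre"
    using snd_zero_if_fst_zero[OF K G.deg_1_transitive_if_pos_0_transitive[OF trans gen]]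
    by (rule rel.fibre_iso)
  ultimately show ?thesis
    using domain rel.ideal_fibre_zero fibre_zero_subset_part
    by (intro exI[of _ ?T] exI[of _ "rel.fibre (lzero G)"]) auto
qed

end

lemma infinite_UNIV_if_K_is_R_or_C:
  assumes "K_is_R_or_C TYPE('k::field)"
  shows "infinite (UNIV :: 'k set)"
  using assms bij_betw_finite[of _ "UNIV :: 'k set"] infinite_UNIV_char_0
  unfolding K_is_R_or_C_def by metis

theorem theorem3p5:
  fixes G :: "('k::field, 'g) lsa" and U :: "('k, 'u) lsa" and j :: "'g \<Rightarrow> 'u"
  assumes "K_is_R_or_C TYPE('k)"
    and "lie_superalgebra G" and "pos_0_transitive G" and "pos_generated G"
    and "universal_lsa G U j"
  shows "(\<exists>T D. T \<subseteq> part U (\<lambda>k. k \<le> 0) \<and> subspace U T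
            \<and> subalgebra U (dsum U T (part U (\<lambda>k. 1 \<le> k)))
            \<and> ideal U (dsum U T (part U (\<lambda>k. 1 \<le> k))) D
            \<and> D \<subseteq> part U (\<lambda>k. 2 \<le> k)
            \<and> (\<exists>f. lsa_iso G (quot U (dsum U T (part U (\<lambda>k. 1 \<le> k))) D) f))
       \<and> (\<forall>T D. T \<subseteq> part U (\<lambda>k. k \<le> 0) \<and> subspace U T
            \<and> subalgebra U (dsum U T (part U (\<lambda>k. 1 \<le> k)))
            \<and> ideal U (dsum U T (part U (\<lambda>k. 1 \<le> k))) D
            \<and> D \<subseteq> part U (\<lambda>k. 2 \<le> k)
            \<longrightarrow> lie_superalgebra (quot U (dsum U T (part U (\<lambda>k. 1 \<le> k))) D)
              \<and> pos_0_transitive (quot U (dsum U T (part U (\<lambda>k. 1 \<le> k))) D)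
              \<and> pos_generated (quot U (dsum U T (part U (\<lambda>k. 1 \<le> k))) D))"
proof (intro conjI allI impI; (elim conjE)?)
  interpret universal_lie_superalg U G j
    by unfold_locales (use assms(2,5) in \<open>auto simp: universal_lsa_def\<close>)
  show "\<exists>T D. T \<subseteq> part U (\<lambda>k. k \<le> 0) \<and> subspace U T
      \<and> subalgebra U (dsum U T (pos_part U)) \<and> ideal U (dsum U T (pos_part U)) D
      \<and> D \<subseteq> part U (\<lambda>k. 2 \<le> k) \<and> (\<exists>f. lsa_iso G (quot U (dsum U T (pos_part U)) D) f)"
    using infinite_UNIV_if_K_is_R_or_C[OF assms(1)] assms(3,4) by (rule ex_quotient_presentation)
  fix T D assume T: "subspace U T" and S: "subalgebra U (dsum U T (pos_part U))"
    and D: "ideal U (dsum U T (pos_part U)) D" "D \<subseteq> part U (\<lambda>k. 2 \<le> k)"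
  have "pos_part U \<subseteq> dsum U T (pos_part U)"
    by (rule U.subset_dsum_right[OF T]) (auto simp: part_def)
  from S this D show "lie_superalgebra (quot U (dsum U T (pos_part U)) D)"
    "pos_0_transitive (quot U (dsum U T (pos_part U)) D)"
    "pos_generated (quot U (dsum U T (pos_part U)) D)"
    by (rule lie_superalgebra_quot pos_0_transitive_quot pos_generated_quot)+
qed

end
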